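(* Let $N\ge 1$ and $k,j,\ell\ge 0$ be integers. The number of partitions of $N$ into parts congruent to $1$ or $4$ modulo $5$ with exactly $k$ $1$'s, $j$ $4$'s and $\ell$ $6$'s is equal to the number of partitions $\lambda\in\mathsf{Diff_2}$ of $N$ such that: (1) if $\lambda$ has at least six parts, then $col(\lambda)$ has exactly $k$ $1$'s, $j$ $4$'s and $\ell$ $6$'s; (2) if $\lambda$ has four or five parts, then $col(\lambda)$ has exactly $k$ $1$'s, $j$ $4$'s and either $2\ell$ or $2\ell+1$ $3$'s; (3) if $\lambda$ has three parts, then one of the following holds: (a) $col(\lambda)=3^{2\ell}2^{2j}1^k$; (b) $col(\lambda)=3^{2\ell}2^{2j+1}1^k$; (c) $col(\lambda)=3^{2\ell-3}2^{2j}1^k$ and $\ell\ge 2$; (d) $col(\lambda)=3^{2\ell+1}2^{2j+1}1^k$; (4) if $\lambda$ has two parts, then either (a) $col(\lambda)=2^{2j-2}1^k$, $j\ge 1$ and $\ell=0$, or (b) $col(\lambda)=2^{2j+1}1^k$ and $\ell=1$; (5) if $\lambda$ has one part, then $col(\lambda)=1^{k-1}$, $k\ge 1$, and $j=\ell=0$.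
   Context: Partitions are written with weakly decreasing positive parts; $3^{a}2^{b}1^{c}$ denotes the partition with $a$ parts equal to $3$, $b$ parts equal to $2$ and $c$ parts equal to $1$. $\mathsf{Diff_2}$ is the set of partitions $\lambda=(\lambda_1,\dots,\lambda_m)$ whose consecutive differences are at least two, i.e. $\lambda_i-\lambda_{i+1}\ge 2$ for $1\le i<m$. For $\lambda=(\lambda_1,\dots,\lambda_m)\in\mathsf{Diff_2}$, $col(\lambda)$ is the partition formed by the columns of (i.e. the conjugate of) $(\lambda_1-(2m-1),\lambda_2-(2m-3),\dots,\lambda_m-1)$, where zero entries are ignored. Example: $col((16,12,7,4,1))=(7,5,2,1,0)^T=(4,3,2,2,2,1,1)$. *)

theory Defs
  imports Main
begin

definition partitions_of :: "nat \<Rightarrow> nat list set" where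
  "partitions_of N =
     {lam. sorted_wrt (\<ge>) lam \<and> (\<forall>x\<in>set lam. 0 < x) \<and> sum_list lam = N}"

definition Diff2 :: "nat list set" where
  "Diff2 = {lam. \<exists>N. lam \<in> partitions_of N \<and>
                 (\<forall>i. Suc i < length lam \<longrightarrow> lam ! Suc i + 2 \<le> lam ! i)}"

text \<open>Since only the columns numbered from 1 onwards are listed, zero entries of the argument are
  ignored; all listed columns are nonempty.\<close>

definition conjugate :: "nat list \<Rightarrow> nat list" where
  "conjugate mu =
     map (\<lambda>c. length (filter (\<lambda>x. c \<le> x) mu)) [1..<Suc (Max (insert 0 (set mu)))]"

text \<open>List positions start at 0, so the entry at position i is the part with index i + 1, from
  which 2(m - i) - 1 has to be subtracted. For a list of length m in Diff2 this part is at least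
  2(m - i) - 1, so the subtraction on natural numbers does not truncate.\<close>

definition col :: "nat list \<Rightarrow> nat list" where
  "col lam = (let m = length lam in
     conjugate (map (\<lambda>i. lam ! i - (2 * (m - i) - 1)) [0..<m]))"

definition parts321 :: "nat \<Rightarrow> nat \<Rightarrow> nat \<Rightarrow> nat list" where
  "parts321 a b c = replicate a 3 @ replicate b 2 @ replicate c 1"

lemma col_example: "col [16, 12, 7, 4, 1] = [4, 3, 2, 2, 2, 1, 1]"
  by code_simp

end

(* Marking 1's, 4's and 6's by variables x, y, z turns the generating function of the partitions into
   parts congruent to 1 or 4 modulo 5 into F(q) / ((1-xq)(1-yq^4)(1-zq^6)) with F independent of
   x, y, z. The conditions on col are such that the partitions in Diff2 have a generating function of
   the same shape, G(q) / ((1-xq)(1-yq^4)(1-zq^6)): this holds separately for each number of parts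
   that is at least four, and for the partitions with at most three parts taken together. At
   x = y = z = 1 the equality F = G is the first Rogers-Ramanujan identity.

   That identity is derived from Schur's polynomials: the generating function of Diff2 with bounded
   largest part satisfies D_n = D_(n-1) + q^n D_(n-2), which is also satisfied by an alternating sum
   of q-binomial coefficients. Modulo any power of q its limit is the theta series of the finite
   Jacobi triple product with base q^5, divided by the product of all 1 - q^i. *)

theory Submission
  imports Defs "HOL-Computational_Algebra.Formal_Power_Series" "HOL-Library.Multiset"
begin

section \<open>Schur's finite sums\<close>

text \<open>The marking variables never occur as variables. The shape F(q) /
  ((1-xq)(1-yq^4)(1-zq^6)) only says that the number of objects of size N with triple t is the
  coefficient of F at N - \<open>weight t\<close>, and this is proved by adding or removing a fixed
  multiset of parts or columns. F = G then follows by strong induction on N: in the identity for all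
  partitions of N, every nonzero triple contributes a coefficient below N, so the coefficients at N
  must agree as well. The obstacle is that short partitions lack long columns. With four or five
  parts there is no column of length 6, and a pair of 3's takes its place. With at most three parts
  there is no column of length 4 either; there 4's and 6's are imitated by 2's, 3's and the m^2
  cells that are subtracted before columns are formed, and the leftovers of one, two and three parts
  have to be combined. No infinite product or limit is formed: all sums and products are finite and
  are compared modulo a power of the variable.\<close>

definition qpoch :: "'a::comm_ring_1 \<Rightarrow> nat \<Rightarrow> 'a" where
  "qpoch q n = (\<Prod>i=1..n. 1 - q ^ i)"

lemma qpoch_0 [simp]: "qpoch q 0 = 1"
  by (simp add: qpoch_def)

lemma qpoch_Suc: "qpoch q (Suc n) = qpoch q n * (1 - q ^ Suc n)"
  by (simp add: qpoch_def)

fun qbinomial :: "'a::comm_ring_1 \<Rightarrow> nat \<Rightarrow> nat \<Rightarrow> 'a" where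
  "qbinomial q n 0 = 1"
| "qbinomial q 0 (Suc k) = 0"
| "qbinomial q (Suc n) (Suc k) = qbinomial q n k + q ^ Suc k * qbinomial q n (Suc k)"

lemma qbinomial_eq_0: "n < k \<Longrightarrow> qbinomial q n k = 0"
  by (induction q n k rule: qbinomial.induct) auto

lemma qbinomial_same [simp]: "qbinomial q n n = 1"
  by (induction n) (auto simp: qbinomial_eq_0)

text \<open>The quotient formula for Gaussian binomials, kept free of division because the ring is
  arbitrary. It is what determines their limit below.\<close>

lemma qbinomial_mult_qpoch:
  "k \<le> n \<Longrightarrow> qbinomial q n k * qpoch q k * qpoch q (n - k) = qpoch q n"
proof (induction q n k rule: qbinomial.induct)
  case (3 q n k)
  show ?case
  proof (cases "k = n")
    case True
    then show ?thesis by (simp add: qbinomial_eq_0)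
  next
    case False
    then have less: "k < n" using 3 by simp
    define d where "d = n - Suc k"
    have n: "n = Suc (k + d)" "n - k = Suc d" "n - Suc k = d" using less by (auto simp: d_def)
    have 1: "qbinomial q n k * qpoch q k * qpoch q (Suc d) = qpoch q n"
      using 3(1) less n by simp
    have 2: "qbinomial q n (Suc k) * qpoch q (Suc k) * qpoch q d = qpoch q n"
      using 3(2) less n by simp
    \<comment> \<open>Each summand of the Pascal rule lacks one factor of a full
      \<open>qpoch\<close>; the missing factors combine to 1 - q^(k+d+2), which is the last factor
      of \<open>qpoch q (Suc n)\<close>.\<close>
    have "qbinomial q (Suc n) (Suc k) * qpoch q (Suc k) * qpoch q (Suc n - Suc k)
        = (qbinomial q n k * qpoch q k * qpoch q (Suc d)) * (1 - q ^ Suc k)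
          + q ^ Suc k * (1 - q ^ Suc d) * (qbinomial q n (Suc k) * qpoch q (Suc k) * qpoch q d)"
      using n by (simp add: qpoch_Suc algebra_simps)
    also have "\<dots> = qpoch q n * ((1 - q ^ Suc k) + q ^ Suc k * (1 - q ^ Suc d))"
      unfolding 1 2 by (simp add: algebra_simps)
    also have "\<dots> = qpoch q (Suc n)"
      using n by (simp add: qpoch_Suc algebra_simps power_add)
    finally show ?thesis .
  qed
qed auto

text \<open>Integer lower index, so that the Pascal rules hold without boundary cases.\<close>

definition qbin :: "'a::comm_ring_1 \<Rightarrow> nat \<Rightarrow> int \<Rightarrow> 'a" where
  "qbin q n k = (if k < 0 then 0 else qbinomial q n (nat k))"

lemma qbin_eq_0: "k < 0 \<or> int n < k \<Longrightarrow> qbin q n k = 0"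
  by (auto simp: qbin_def qbinomial_eq_0)

lemma qbin_0: "qbin q 0 k = (if k = 0 then 1 else 0)"
  by (auto simp: qbin_def qbinomial_eq_0)

lemma qbin_pascal1: "qbin q (Suc n) k = qbin q n (k - 1) + q ^ nat k * qbin q n k"
proof -
  consider "k < 0" | "k = 0" | m where "k = int (Suc m)"
    by (metis linorder_less_linear pos_int_cases Suc_pred)
  then show ?thesis
  proof cases
    case 3
    then have "nat (k - 1) = m" "nat k = Suc m" "0 < k" by auto
    then show ?thesis by (simp add: qbin_def)
  qed (auto simp: qbin_def)
qed

lemma qbin_pascal2: "qbin q (Suc n) k = q ^ nat (int n + 1 - k) * qbin q n (k - 1) + qbin q n k"
proof (induction n arbitrary: k)
  case 0
  then show ?case by (auto simp: qbin_pascal1 qbin_0)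
next
  case (Suc n)
  \<comment> \<open>Both exponents add up to n + 1 where the coefficient can be nonzero. Elsewhere
    \<open>nat\<close> may truncate, but then the coefficient is 0.\<close>
  have a: "q ^ nat k * (q ^ nat (int n + 1 - k) * qbin q n (k - 1))
         = q ^ nat (int n + 2 - k) * (q ^ nat (k - 1) * qbin q n (k - 1))"
  proof (cases "1 \<le> k \<and> k \<le> int n + 1")
    case True
    then have "nat k + nat (int n + 1 - k) = nat (int n + 2 - k) + nat (k - 1)" by auto
    then show ?thesis by (simp flip: power_add mult.assoc)
  next
    case False
    then have "qbin q n (k - 1) = 0" by (intro qbin_eq_0) auto
    then show ?thesis by simp
  qed
  have "qbin q (Suc (Suc n)) k = qbin q (Suc n) (k - 1) + q ^ nat k * qbin q (Suc n) k"
    by (rule qbin_pascal1)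
  also have "\<dots> = q ^ nat (int n + 2 - k) * qbin q n (k - 2) + qbin q n (k - 1)
      + q ^ nat k * (q ^ nat (int n + 1 - k) * qbin q n (k - 1)) + q ^ nat k * qbin q n k"
    using Suc.IH[of k] Suc.IH[of "k - 1"] by (simp add: algebra_simps)
  also have "\<dots> = q ^ nat (int n + 2 - k) * qbin q (Suc n) (k - 1) + qbin q (Suc n) k"
    unfolding a qbin_pascal1[of q n "k - 1"] qbin_pascal1[of q n k] by (simp add: algebra_simps)
  finally show ?case by (simp add: algebra_simps)
qed

text \<open>Pascal's rule with a monomial in front, so that exponents are added as integers and
  truncation by \<open>nat\<close> is settled once. The base q^d serves d = 1 for Schur's sums and d
  = 5 for the triple product.\<close>

lemma power_qbin_pascal1:
  assumes "0 \<le> a"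
  shows "q ^ nat a * qbin (q ^ d) (Suc n) k
       = q ^ nat a * qbin (q ^ d) n (k - 1) + q ^ nat (a + int d * k) * qbin (q ^ d) n k"
proof (cases "k < 0")
  case True
  then show ?thesis by (simp add: qbin_eq_0)
next
  case False
  then have "nat (a + int d * k) = nat a + d * nat k" using assms by (simp add: nat_add_distrib nat_mult_distrib)
  then show ?thesis by (simp add: qbin_pascal1 power_add power_mult algebra_simps)
qed

lemma power_qbin_pascal2:
  assumes "0 \<le> a"
  shows "q ^ nat a * qbin (q ^ d) (Suc n) k
       = q ^ nat (a + int d * (int n + 1 - k)) * qbin (q ^ d) n (k - 1) + q ^ nat a * qbin (q ^ d) n k"
proof (cases "k > int n + 1")
  case True
  then show ?thesis by (simp add: qbin_eq_0)
next
  case False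
  then have "nat (a + int d * (int n + 1 - k)) = nat a + d * nat (int n + 1 - k)"
    using assms by (simp add: nat_add_distrib nat_mult_distrib)
  then show ?thesis by (simp add: qbin_pascal2 power_add power_mult algebra_simps)
qed

lemmas power_qbin_pascal1_1 = power_qbin_pascal1[where d = 1, unfolded power_one_right of_nat_1 mult_1]
lemmas power_qbin_pascal2_1 = power_qbin_pascal2[where d = 1, unfolded power_one_right of_nat_1 mult_1]

lemma sum_int_shift:
  fixes f :: "int \<Rightarrow> 'a::comm_monoid_add"
  assumes "\<And>i. i \<le> A \<or> B \<le> i \<Longrightarrow> f i = 0"
  shows "(\<Sum>i=A..B. f (i + 1)) = (\<Sum>i=A..B. f i)" "(\<Sum>i=A..B. f (i - 1)) = (\<Sum>i=A..B. f i)"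
proof -
  have "(\<Sum>i=A..B. f (i + 1)) = (\<Sum>i\<in>(\<lambda>i. i + 1) ` {A..B}. f i)"
    by (subst sum.reindex) (auto simp: inj_on_def)
  also have "\<dots> = (\<Sum>i=A..B. f i)"
    using assms by (intro sum.mono_neutral_cong) auto
  finally show "(\<Sum>i=A..B. f (i + 1)) = (\<Sum>i=A..B. f i)" .
  have "(\<Sum>i=A..B. f (i - 1)) = (\<Sum>i\<in>(\<lambda>i. i - 1) ` {A..B}. f i)"
    by (subst sum.reindex) (auto simp: inj_on_def)
  also have "\<dots> = (\<Sum>i=A..B. f i)"
    using assms by (intro sum.mono_neutral_cong) auto
  finally show "(\<Sum>i=A..B. f (i - 1)) = (\<Sum>i=A..B. f i)" .
qed

text \<open>The values of j(5j+1)/2 at j = 2i and at j = 2i - 1, written without division.\<close>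

definition schur_exp0 :: "int \<Rightarrow> int" where "schur_exp0 i = 10 * i * i + i"
definition schur_exp1 :: "int \<Rightarrow> int" where "schur_exp1 i = 10 * i * i - 9 * i + 2"

lemma int_le_square: "i \<le> i * i" "- i \<le> i * i" for i :: int
proof -
  have "0 \<le> i * (i - 1)" "0 \<le> i * (i + 1)"
    by (cases "i \<le> 0"; simp add: mult_nonpos_nonpos)
      (cases "i < 0"; simp add: mult_nonpos_nonpos)
  then show "i \<le> i * i" "- i \<le> i * i" by (simp_all add: algebra_simps)
qed

text \<open>Serves twice: the exponents are nonnegative, so \<open>nat\<close> does not truncate
  them, and modulo X^K only the terms with \<bar>i\<bar> < K survive.\<close>

lemma schur_exp_ge: "\<bar>i\<bar> \<le> schur_exp0 i" "\<bar>i\<bar> \<le> schur_exp1 i"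
proof -
  show "\<bar>i\<bar> \<le> schur_exp0 i" using int_le_square[of i] by (simp add: schur_exp0_def)
  show "\<bar>i\<bar> \<le> schur_exp1 i" using int_le_square[of i] by (simp add: schur_exp1_def)
qed

text \<open>With N = 2m and N = 2m + 1, these are Schur's sums of
  (-1)^j q^(j(5j+1)/2) [N choose (N - 5j) div 2] over all j; the terms j = 2i and j = 2i - 1 are
  paired up, because the recurrences hold pair by pair, up to a shift of i. Terms with large i vanish, so that L is
  irrelevant once it exceeds m.\<close>

definition schur_even :: "'a::comm_ring_1 \<Rightarrow> int \<Rightarrow> nat \<Rightarrow> 'a" where
  "schur_even q L m = (\<Sum>i=-L..L. q ^ nat (schur_exp0 i) * qbin q (2 * m) (int m - 5 * i)
                               - q ^ nat (schur_exp1 i) * qbin q (2 * m) (int m + 2 - 5 * i))"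

definition schur_odd :: "'a::comm_ring_1 \<Rightarrow> int \<Rightarrow> nat \<Rightarrow> 'a" where
  "schur_odd q L m = (\<Sum>i=-L..L. q ^ nat (schur_exp0 i) * qbin q (2 * m + 1) (int m - 5 * i)
                               - q ^ nat (schur_exp1 i) * qbin q (2 * m + 1) (int m + 3 - 5 * i))"

lemma schur_even_Suc:
  "schur_even q L (Suc m) = schur_odd q L m + q ^ (2 * m + 1) * schur_even q L m"
proof -
  have "q ^ nat (schur_exp0 i) * qbin q (2 * Suc m) (int (Suc m) - 5 * i)
        - q ^ nat (schur_exp1 i) * qbin q (2 * Suc m) (int (Suc m) + 2 - 5 * i)
      = (q ^ nat (schur_exp0 i) * qbin q (2 * m + 1) (int m - 5 * i)
        - q ^ nat (schur_exp1 i) * qbin q (2 * m + 1) (int m + 3 - 5 * i))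
      + q ^ (2 * m + 1) * (q ^ nat (schur_exp0 i) * qbin q (2 * m) (int m - 5 * i)
        - q ^ nat (schur_exp1 i) * qbin q (2 * m) (int m + 2 - 5 * i))" for i
  proof -
    \<comment> \<open>The first Pascal rule on one coefficient and the second on the other leave
      remainders with the same power q^c. Expanding these with the rules exchanged produces a common
      term, which cancels in the difference.\<close>
    define c where "c = 10 * i * i - 4 * i + int m + 1"
    have c: "0 \<le> c" using int_le_square[of i] by (simp add: c_def)
    note nonneg = order_trans[OF abs_ge_zero schur_exp_ge(1)[of i]]
       order_trans[OF abs_ge_zero schur_exp_ge(2)[of i]]
    have 1: "q ^ nat (schur_exp0 i) * qbin q (Suc (2 * m + 1)) (int m + 1 - 5 * i)
      = q ^ nat (schur_exp0 i) * qbin q (2 * m + 1) (int m - 5 * i) + q ^ nat c * qbin q (2 * m + 1) (int m + 1 - 5 * i)"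
      unfolding power_qbin_pascal1_1[OF nonneg(1)] by (simp add: c_def schur_exp0_def algebra_simps)
    have 2: "q ^ nat (schur_exp1 i) * qbin q (Suc (2 * m + 1)) (int m + 3 - 5 * i)
      = q ^ nat c * qbin q (2 * m + 1) (int m + 2 - 5 * i) + q ^ nat (schur_exp1 i) * qbin q (2 * m + 1) (int m + 3 - 5 * i)"
      unfolding power_qbin_pascal2_1[OF nonneg(2)] by (simp add: c_def schur_exp1_def algebra_simps)
    have 3: "q ^ nat c * qbin q (Suc (2 * m)) (int m + 1 - 5 * i)
      = q ^ (2 * m + 1) * (q ^ nat (schur_exp0 i) * qbin q (2 * m) (int m - 5 * i)) + q ^ nat c * qbin q (2 * m) (int m + 1 - 5 * i)"
    proof -
      have "nat (c + int (2 * m) + 1 - (int m + 1 - 5 * i)) = nat (schur_exp0 i + int (2 * m + 1))"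
        by (simp add: c_def schur_exp0_def algebra_simps)
      also have "\<dots> = (2 * m + 1) + nat (schur_exp0 i)"
        using nonneg by simp
      finally show ?thesis
        unfolding power_qbin_pascal2_1[OF c] by (simp add: power_add algebra_simps)
    qed
    have 4: "q ^ nat c * qbin q (Suc (2 * m)) (int m + 2 - 5 * i)
      = q ^ nat c * qbin q (2 * m) (int m + 1 - 5 * i) + q ^ (2 * m + 1) * (q ^ nat (schur_exp1 i) * qbin q (2 * m) (int m + 2 - 5 * i))"
    proof -
      have "nat (c + (int m + 2 - 5 * i)) = nat (schur_exp1 i + int (2 * m + 1))"
        by (simp add: c_def schur_exp1_def algebra_simps)
      also have "\<dots> = (2 * m + 1) + nat (schur_exp1 i)"
        using nonneg by simp
      finally show ?thesis
        unfolding power_qbin_pascal1_1[OF c] by (simp add: power_add algebra_simps)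
    qed
    have s: "2 * Suc m = Suc (2 * m + 1)" "int (Suc m) - 5 * i = int m + 1 - 5 * i"
      "int (Suc m) + 2 - 5 * i = int m + 3 - 5 * i" "2 * m + 1 = Suc (2 * m)" by simp_all
    show ?thesis
      unfolding s(1-3) 1 2 unfolding s(4) 3 4 by (simp add: algebra_simps)
  qed
  then show ?thesis
    unfolding schur_even_def schur_odd_def sum_distrib_left by (simp only: sum.distrib)
qed

text \<open>Unlike the other recurrence this one fails pair by pair: the remainder of the first term
  at i has the power of q of the remainder of the second term at i + 1. The sums of \<open>g\<close>
  and \<open>h\<close> are therefore shifted by one, and the bound on L makes their terms vanish at
  both ends of the range.\<close>

lemma schur_odd_Suc:
  assumes "int m + 3 \<le> L"
  shows "schur_odd q L (Suc m) = schur_even q L (Suc m) + q ^ (2 * m + 2) * schur_odd q L m"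
proof -
  define c where "c i = 10 * i * i + 6 * i + int m + 2" for i
  have c: "0 \<le> c i" for i using int_le_square[of i] by (simp add: c_def)
  note nonneg = order_trans[OF abs_ge_zero schur_exp_ge(1)]
       order_trans[OF abs_ge_zero schur_exp_ge(2)]
  define g where "g i = q ^ nat (c (i - 1)) * qbin q (2 * m + 2) (int m + 4 - 5 * i)" for i
  define h where "h i = q ^ (2 * m + 2) * (q ^ nat (schur_exp1 i) * qbin q (2 * m + 1) (int m + 3 - 5 * i))" for i
  have 1: "q ^ nat (schur_exp0 i) * qbin q (Suc (2 * m + 2)) (int m + 1 - 5 * i)
      = q ^ nat (c i) * qbin q (2 * m + 2) (int m - 5 * i) + q ^ nat (schur_exp0 i) * qbin q (2 * m + 2) (int m + 1 - 5 * i)" for i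
    unfolding power_qbin_pascal2_1[OF nonneg(1)] by (simp add: c_def schur_exp0_def algebra_simps)
  have 2: "q ^ nat (schur_exp1 i) * qbin q (Suc (2 * m + 2)) (int m + 4 - 5 * i)
      = q ^ nat (schur_exp1 i) * qbin q (2 * m + 2) (int m + 3 - 5 * i) + g i" for i
    unfolding power_qbin_pascal1_1[OF nonneg(2)] by (simp add: g_def c_def schur_exp1_def algebra_simps)
  have 3: "q ^ nat (c i) * qbin q (Suc (2 * m + 1)) (int m - 5 * i)
      = q ^ nat (c i) * qbin q (2 * m + 1) (int m - 1 - 5 * i) + q ^ (2 * m + 2) * (q ^ nat (schur_exp0 i) * qbin q (2 * m + 1) (int m - 5 * i))" for i
  proof -
    have "nat (c i + (int m - 5 * i)) = nat (schur_exp0 i + int (2 * m + 2))"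
      by (simp add: c_def schur_exp0_def algebra_simps)
    also have "\<dots> = (2 * m + 2) + nat (schur_exp0 i)"
      using nonneg[of i] by simp
    finally show ?thesis
      unfolding power_qbin_pascal1_1[OF c] by (simp add: power_add algebra_simps)
  qed
  have 4: "g (i + 1) = h (i + 1) + q ^ nat (c i) * qbin q (2 * m + 1) (int m - 1 - 5 * i)" for i
  proof -
    have "nat (c i + int (2 * m + 1) + 1 - (int m - 1 - 5 * i)) = nat (schur_exp1 (i + 1) + int (2 * m + 2))"
      by (simp add: c_def schur_exp1_def algebra_simps)
    also have "\<dots> = (2 * m + 2) + nat (schur_exp1 (i + 1))"
      using nonneg[of "i + 1"] by simp
    finally have "q ^ nat (c i) * qbin q (Suc (2 * m + 1)) (int m - 1 - 5 * i)
      = h (i + 1) + q ^ nat (c i) * qbin q (2 * m + 1) (int m - 1 - 5 * i)"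
      unfolding power_qbin_pascal2_1[OF c] h_def by (simp add: power_add algebra_simps)
    then show ?thesis by (simp add: g_def algebra_simps)
  qed
  have g: "(\<Sum>i=-L..L. g (i + 1)) = (\<Sum>i=-L..L. g i)"
    using assms by (intro sum_int_shift) (auto simp: g_def qbin_eq_0)
  have h: "(\<Sum>i=-L..L. h (i + 1)) = (\<Sum>i=-L..L. h i)"
    using assms by (intro sum_int_shift) (auto simp: h_def qbin_eq_0)
  have "schur_odd q L (Suc m) = (\<Sum>i=-L..L.
       q ^ nat (schur_exp0 i) * qbin q (Suc (2 * m + 2)) (int m + 1 - 5 * i)
     - q ^ nat (schur_exp1 i) * qbin q (Suc (2 * m + 2)) (int m + 4 - 5 * i))"
    unfolding schur_odd_def by (intro sum.cong) (simp_all add: algebra_simps)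
  also have "\<dots> = schur_even q L (Suc m) + (\<Sum>i=-L..L. q ^ nat (c i) * qbin q (2 * m + 2) (int m - 5 * i))
       - (\<Sum>i=-L..L. g (i + 1))"
    unfolding schur_even_def g 1 2 by (simp add: sum.distrib sum_subtractf algebra_simps)
  finally have 5: "schur_odd q L (Suc m) = schur_even q L (Suc m)
      + ((\<Sum>i=-L..L. q ^ nat (c i) * qbin q (2 * m + 2) (int m - 5 * i)) - (\<Sum>i=-L..L. g (i + 1)))"
    by (simp add: algebra_simps)
  have "(\<Sum>i=-L..L. q ^ nat (c i) * qbin q (2 * m + 2) (int m - 5 * i)) - (\<Sum>i=-L..L. g (i + 1))
     = (\<Sum>i=-L..L. q ^ (2 * m + 2) * (q ^ nat (schur_exp0 i) * qbin q (2 * m + 1) (int m - 5 * i)))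
       - (\<Sum>i=-L..L. h (i + 1))"
    using 3 unfolding 4 by (simp add: sum.distrib)
  also have "\<dots> = q ^ (2 * m + 2) * schur_odd q L m"
    unfolding h unfolding schur_odd_def h_def by (simp add: sum_subtractf sum_distrib_left algebra_simps)
  finally show ?thesis unfolding 5 by simp
qed

lemma schur_even_0: "0 \<le> L \<Longrightarrow> schur_even q L 0 = 1"
proof -
  assume "0 \<le> L"
  have "schur_even q L 0 = (\<Sum>i=-L..L. if i = 0 then 1 else 0)"
    unfolding schur_even_def
  proof (intro sum.cong refl)
    fix i :: int
    have "5 * i \<noteq> 2" by presburger
    then show "q ^ nat (schur_exp0 i) * qbin q (2 * 0) (int 0 - 5 * i)
      - q ^ nat (schur_exp1 i) * qbin q (2 * 0) (int 0 + 2 - 5 * i) = (if i = 0 then 1 else 0)"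
      by (simp add: qbin_0 schur_exp0_def)
  qed
  then show ?thesis using \<open>0 \<le> L\<close> by (simp add: sum.delta')
qed

lemma schur_odd_0: "0 \<le> L \<Longrightarrow> schur_odd q L 0 = 1"
proof -
  assume "0 \<le> L"
  have "schur_odd q L 0 = (\<Sum>i=-L..L. if i = 0 then 1 else 0)"
    unfolding schur_odd_def
  proof (intro sum.cong refl)
    fix i :: int
    have "5 * i \<noteq> 2" "5 * i \<noteq> 3" "5 * i \<noteq> -1" by presburger+
    then show "q ^ nat (schur_exp0 i) * qbin q (2 * 0 + 1) (int 0 - 5 * i)
      - q ^ nat (schur_exp1 i) * qbin q (2 * 0 + 1) (int 0 + 3 - 5 * i) = (if i = 0 then 1 else 0)"
      by (simp add: qbin_pascal1 qbin_0 schur_exp0_def)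
  qed
  then show ?thesis using \<open>0 \<le> L\<close> by (simp add: sum.delta')
qed

section \<open>The finite Jacobi triple product\<close>

definition sign :: "int \<Rightarrow> 'a::comm_ring_1" where
  "sign s = (if even s then 1 else - 1)"

definition jacobi_exp :: "int \<Rightarrow> int" where
  "jacobi_exp s = s * (5 * s + 1) div 2"

lemma jacobi_exp_double: "2 * jacobi_exp s = s * (5 * s + 1)"
  unfolding jacobi_exp_def by (rule dvd_mult_div_cancel) (cases "even s"; simp)

lemma jacobi_exp_ge: "\<bar>s\<bar> \<le> jacobi_exp s"
  using int_le_square[of s] jacobi_exp_double[of s] by (simp add: algebra_simps)

lemma jacobi_exp_even: "jacobi_exp (2 * i) = schur_exp0 i"
  using jacobi_exp_double[of "2 * i"] by (simp add: schur_exp0_def algebra_simps)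

lemma jacobi_exp_odd: "jacobi_exp (2 * i - 1) = schur_exp1 i"
  using jacobi_exp_double[of "2 * i - 1"] by (simp add: schur_exp1_def algebra_simps)

text \<open>The sum side of the finite triple product with base Q = q^5, that is z^s Q^(s(s-1)/2)
  [2n choose n+s] summed over s, at z = -q^3. Terms with \<bar>s\<bar> > n vanish, so A and B can
  stay fixed during an induction on n.\<close>

definition jacobi_sum :: "'a::comm_ring_1 \<Rightarrow> int \<Rightarrow> int \<Rightarrow> nat \<Rightarrow> 'a" where
  "jacobi_sum q A B n = (\<Sum>s=A..B. sign s * (q ^ nat (jacobi_exp s) * qbin (q ^ 5) (2 * n) (int n + s)))"

lemma jacobi_sum_0: "A \<le> 0 \<Longrightarrow> 0 \<le> B \<Longrightarrow> jacobi_sum q A B 0 = 1"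
proof -
  assume *: "A \<le> 0" "0 \<le> B"
  have "jacobi_sum q A B 0 = (\<Sum>s=A..B. if s = 0 then 1 else 0)"
    unfolding jacobi_sum_def by (intro sum.cong refl) (simp add: qbin_0 sign_def jacobi_exp_def)
  then show ?thesis using * by (simp add: sum.delta')
qed

text \<open>Two Pascal steps lead from 2n + 2 to 2n. Since the exponent is quadratic in s, the
  resulting terms are neighbours of \<open>g s\<close> up to powers of q independent of s. Summation
  over s identifies the neighbours, and the collected factor splits into two.\<close>

lemma jacobi_sum_Suc:
  assumes "A < - int n" "int n < B"
  shows "jacobi_sum q A B (Suc n) = (1 - q ^ (5 * n + 2)) * (1 - q ^ (5 * n + 3)) * jacobi_sum q A B n"
proof -
  define g where "g s = sign s * (q ^ nat (jacobi_exp s) * qbin (q ^ 5) (2 * n) (int n + s))" for s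
  have e: "0 \<le> jacobi_exp s" for s using jacobi_exp_ge[of s] by simp
  have term_eq: "sign s * (q ^ nat (jacobi_exp s) * qbin (q ^ 5) (2 * Suc n) (int (Suc n) + s))
      = (1 + q ^ (10 * n + 5)) * g s - q ^ (5 * n + 3) * g (s - 1) - q ^ (5 * n + 2) * g (s + 1)" for s
  proof -
    define b where "b = jacobi_exp (s + 1) + int (5 * n + 2)"
    have b: "b = jacobi_exp s + 5 * (int n + 1 + s)"
      using jacobi_exp_double[of s] jacobi_exp_double[of "s + 1"] by (simp add: b_def algebra_simps)
    have b0: "0 \<le> b" using e[of "s + 1"] by (simp add: b_def)
    have c: "jacobi_exp s + 5 * (int n + 1 - s) = jacobi_exp (s - 1) + int (5 * n + 3)"
      using jacobi_exp_double[of s] jacobi_exp_double[of "s - 1"] by (simp add: algebra_simps)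
    have 1: "q ^ nat (jacobi_exp s) * qbin (q ^ 5) (Suc (2 * n + 1)) (int n + 1 + s)
        = q ^ nat (jacobi_exp s) * qbin (q ^ 5) (Suc (2 * n)) (int n + s)
        + q ^ nat b * qbin (q ^ 5) (Suc (2 * n)) (int n + 1 + s)"
      unfolding b by (subst power_qbin_pascal1[OF e]) (simp add: algebra_simps)
    have 2: "q ^ nat (jacobi_exp s) * qbin (q ^ 5) (Suc (2 * n)) (int n + s)
        = q ^ nat (jacobi_exp (s - 1) + int (5 * n + 3)) * qbin (q ^ 5) (2 * n) (int n + (s - 1))
        + q ^ nat (jacobi_exp s) * qbin (q ^ 5) (2 * n) (int n + s)"
      unfolding power_qbin_pascal2[OF e] c[symmetric] by (simp add: algebra_simps)
    have 3: "q ^ nat b * qbin (q ^ 5) (Suc (2 * n)) (int n + 1 + s)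
        = q ^ nat (jacobi_exp s + int (10 * n + 5)) * qbin (q ^ 5) (2 * n) (int n + s)
        + q ^ nat b * qbin (q ^ 5) (2 * n) (int n + (s + 1))"
      unfolding power_qbin_pascal2[OF b0] by (simp add: b algebra_simps)
    have p: "q ^ nat (jacobi_exp t + int k) = q ^ k * q ^ nat (jacobi_exp t)" for t k
      using e[of t] by (simp add: nat_add_distrib power_add)
    have s: "2 * Suc n = Suc (2 * n + 1)" "int (Suc n) + s = int n + 1 + s" by simp_all
    have sg: "sign (s - 1) = (- sign s :: 'a)" "sign (s + 1) = (- sign s :: 'a)"
      by (auto simp: sign_def)
    show ?thesis
      unfolding s 1 2 3 g_def sg unfolding b_def p by (simp add: algebra_simps)
  qed
  have g0: "g s = 0" if "s \<le> A \<or> B \<le> s" for s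
    using that assms by (auto simp: g_def qbin_eq_0)
  have "jacobi_sum q A B (Suc n)
      = (1 + q ^ (10 * n + 5)) * (\<Sum>s=A..B. g s) - q ^ (5 * n + 3) * (\<Sum>s=A..B. g (s - 1))
        - q ^ (5 * n + 2) * (\<Sum>s=A..B. g (s + 1))"
    unfolding jacobi_sum_def term_eq by (simp only: sum_subtractf sum_distrib_left)
  also have "\<dots> = (1 + q ^ (10 * n + 5) - q ^ (5 * n + 3) - q ^ (5 * n + 2)) * jacobi_sum q A B n"
    using sum_int_shift[of A B g, OF g0] by (simp add: jacobi_sum_def g_def algebra_simps)
  also have "1 + q ^ (10 * n + 5) - q ^ (5 * n + 3) - q ^ (5 * n + 2) = (1 - q ^ (5 * n + 2)) * (1 - q ^ (5 * n + 3))"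
  proof -
    have "q ^ (10 * n + 5) = q ^ ((5 * n + 2) + (5 * n + 3))" by (rule arg_cong) simp
    then have "q ^ (10 * n + 5) = q ^ (5 * n + 2) * q ^ (5 * n + 3)" by (simp only: power_add)
    then show ?thesis by (simp only: algebra_simps mult_1_left)
  qed
  finally show ?thesis .
qed

lemma jacobi_sum_eq_prod:
  assumes "A < - int n" "int n < B"
  shows "jacobi_sum q A B n = (\<Prod>i<n. (1 - q ^ (5 * i + 2)) * (1 - q ^ (5 * i + 3)))"
  using assms
proof (induction n)
  case (Suc n)
  then show ?case by (simp add: jacobi_sum_Suc mult.commute)
qed (simp add: jacobi_sum_0)

text \<open>Arranges the theta series in the pairs in which Schur's sums are written.\<close>

lemma sum_int_pairs:
  fixes f :: "int \<Rightarrow> 'a::comm_monoid_add"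
  shows "(\<Sum>s=-2*L-1..2*L. f s) = (\<Sum>i=-L..L. f (2 * i) + f (2 * i - 1))"
proof -
  have "{-2*L-1..2*L} = (\<lambda>i. 2 * i) ` {-L..L} \<union> (\<lambda>i. 2 * i - 1) ` {-L..L}"
  proof (intro equalityI subsetI)
    fix s assume "s \<in> {-2*L-1..2*L}"
    moreover have "s = 2 * (s div 2) \<or> s = 2 * ((s + 1) div 2) - 1" by presburger
    moreover have "s div 2 \<in> {-L..L}" if "s = 2 * (s div 2)" using that calculation(1) by auto
    moreover have "(s + 1) div 2 \<in> {-L..L}" if "s = 2 * ((s + 1) div 2) - 1" using that calculation(1) by auto
    ultimately show "s \<in> (\<lambda>i. 2 * i) ` {-L..L} \<union> (\<lambda>i. 2 * i - 1) ` {-L..L}"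
      by blast
  qed auto
  moreover have "(\<lambda>i. 2 * i) ` {-L..L} \<inter> (\<lambda>i. 2 * i - 1) ` {-L..L} = {}"
    by auto presburger
  ultimately show ?thesis
    by (simp add: sum.union_disjoint sum.reindex inj_on_def sum.distrib)
qed

section \<open>Power series modulo a power of the variable\<close>

definition fps_cong :: "nat \<Rightarrow> 'a::comm_ring_1 fps \<Rightarrow> 'a fps \<Rightarrow> bool" where
  "fps_cong K f g \<longleftrightarrow> (\<forall>i<K. fps_nth f i = fps_nth g i)"

lemma fps_cong_refl [simp]: "fps_cong K f f"
  by (simp add: fps_cong_def)

lemma fps_cong_sym: "fps_cong K f g \<Longrightarrow> fps_cong K g f"
  by (simp add: fps_cong_def)

lemma fps_cong_trans [trans]: "fps_cong K f g \<Longrightarrow> fps_cong K g h \<Longrightarrow> fps_cong K f h"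
  by (simp add: fps_cong_def)

lemma fps_cong_diff: "fps_cong K f g \<Longrightarrow> fps_cong K f' g' \<Longrightarrow> fps_cong K (f - f') (g - g')"
  by (simp add: fps_cong_def)

lemma fps_cong_mult: "fps_cong K f g \<Longrightarrow> fps_cong K f' g' \<Longrightarrow> fps_cong K (f * f') (g * g')"
  by (auto simp: fps_cong_def fps_mult_nth intro!: sum.cong)

lemma fps_cong_sum: "(\<And>x. x \<in> A \<Longrightarrow> fps_cong K (f x) (g x)) \<Longrightarrow> fps_cong K (sum f A) (sum g A)"
  by (auto simp: fps_cong_def fps_sum_nth intro!: sum.cong)

lemma fps_cong_mult_cancel:
  fixes f g h :: "'a::field fps"
  assumes "fps_cong K (f * h) (g * h)" "fps_nth h 0 \<noteq> 0"
  shows "fps_cong K f g"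
proof -
  have "fps_cong K (f * h * inverse h) (g * h * inverse h)"
    by (rule fps_cong_mult[OF assms(1) fps_cong_refl])
  then show ?thesis
    by (simp only: mult.assoc inverse_mult_eq_1'[OF assms(2)] mult_1_right)
qed

lemma fps_cong_X_power: "K \<le> e \<Longrightarrow> fps_cong K (fps_X ^ e * f) 0"
  by (auto simp: fps_cong_def fps_X_power_mult_nth)

lemma qpoch_nth_0: "0 < d \<Longrightarrow> fps_nth (qpoch (fps_X ^ d :: 'a::field fps) n) 0 = 1"
  by (induction n) (auto simp: qpoch_Suc simp flip: power_mult)

text \<open>The factors with index above K are congruent to 1, so all \<open>qpoch\<close> of length
  at least K agree modulo X^K.\<close>

lemma qpoch_cong:
  assumes "0 < d" "K \<le> a" "a \<le> b"
  shows "fps_cong K (qpoch (fps_X ^ d :: 'a::field fps) b) (qpoch (fps_X ^ d) a)"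
  using assms(3)
proof (induction b rule: dec_induct)
  case (step n)
  have "K \<le> d * Suc n" using assms step by (cases d) auto
  then have "fps_cong K (1 - fps_X ^ (d * Suc n) * 1 :: 'a fps) (1 - 0)"
    by (intro fps_cong_diff fps_cong_X_power) auto
  from fps_cong_mult[OF step.IH this] show ?case
    by (simp only: qpoch_Suc power_mult mult_1_right diff_zero)
qed simp

text \<open>The coefficient is (Q)_n / ((Q)_k (Q)_(n-k)) with all three lengths at least K, so
  modulo X^K it is 1 / (Q)_N. In the proof (Q)_N is traded for (Q)_k, and (Q)_(n-k) is cancelled at
  the end.\<close>

lemma qbin_qpoch_cong:
  assumes "0 < d" "int K \<le> k" "k + int K \<le> int n" "K \<le> N"
  shows "fps_cong K (qbin (fps_X ^ d :: 'a::field fps) n k * qpoch (fps_X ^ d) N) 1"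
proof -
  define Q where "Q = (fps_X ^ d :: 'a fps)"
  define m where "m = nat k"
  have m: "K \<le> m" "m + K \<le> n" "qbin Q n k = qbinomial Q n m" using assms by (auto simp: m_def qbin_def)
  have c: "fps_cong K (qpoch Q a) (qpoch Q b)" if "K \<le> a" "K \<le> b" for a b
    using qpoch_cong[OF assms(1), of K a b] qpoch_cong[OF assms(1), of K b a] that
    by (cases "a \<le> b") (auto simp: Q_def intro: fps_cong_sym)
  have "fps_cong K (qbinomial Q n m * qpoch Q N * qpoch Q (n - m)) (qbinomial Q n m * qpoch Q m * qpoch Q (n - m))"
    using m assms by (intro fps_cong_mult c) auto
  also have "qbinomial Q n m * qpoch Q m * qpoch Q (n - m) = 1 * qpoch Q n"
    using m by (simp add: qbinomial_mult_qpoch)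
  also have "fps_cong K (1 * qpoch Q n) (1 * qpoch Q (n - m))"
    using m by (intro fps_cong_mult c) auto
  finally show ?thesis
    unfolding m(3)[symmetric] unfolding Q_def
    by (rule fps_cong_mult_cancel) (simp add: qpoch_nth_0 assms)
qed

lemma X_power_qbin_qpoch_cong:
  assumes "0 < d" "K \<le> e \<or> int K \<le> k \<and> k + int K \<le> int n" "K \<le> N"
  shows "fps_cong K (fps_X ^ e * qbin (fps_X ^ d :: 'a::field fps) n k * qpoch (fps_X ^ d) N) (fps_X ^ e)"
proof (cases "K \<le> e")
  case True
  have "fps_cong K (fps_X ^ e * (qbin (fps_X ^ d :: 'a::field fps) n k * qpoch (fps_X ^ d) N)) 0"
    by (rule fps_cong_X_power[OF True])
  moreover have "fps_cong K 0 (fps_X ^ e * 1 :: 'a fps)"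
    by (rule fps_cong_sym[OF fps_cong_X_power[OF True]])
  ultimately show ?thesis using fps_cong_trans by (simp add: mult.assoc) blast
next
  case False
  then have "fps_cong K (fps_X ^ e * (qbin (fps_X ^ d :: 'a::field fps) n k * qpoch (fps_X ^ d) N)) (fps_X ^ e * 1)"
    using assms by (intro fps_cong_mult qbin_qpoch_cong) auto
  then show ?thesis by (simp add: mult.assoc)
qed

text \<open>Terms with \<bar>i\<bar> \<ge> K vanish modulo X^K. For the others the lower index is at
  most 5(K-1) + 2 away from m and must keep distance K from 0 and from 2m;
  \<open>6 * K + 2 \<le> m\<close> suffices for that.\<close>

lemma schur_even_qpoch_cong:
  assumes "6 * K + 2 \<le> m" "K \<le> N"
  shows "fps_cong K (schur_even (fps_X :: 'a::field fps) L m * qpoch fps_X N)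
           (\<Sum>i=-L..L. fps_X ^ nat (schur_exp0 i) - fps_X ^ nat (schur_exp1 i))"
proof -
  have big: "K \<le> nat (schur_exp0 i)" "K \<le> nat (schur_exp1 i)" if "int K \<le> \<bar>i\<bar>" for i
    using schur_exp_ge[of i] that by linarith+
  have "fps_cong K (fps_X ^ nat (schur_exp0 i) * qbin (fps_X ^ 1 :: 'a fps) (2 * m) (int m - 5 * i) * qpoch (fps_X ^ 1) N)
           (fps_X ^ nat (schur_exp0 i))" for i
    using assms big[of i] by (intro X_power_qbin_qpoch_cong) linarith+
  moreover have "fps_cong K (fps_X ^ nat (schur_exp1 i) * qbin (fps_X ^ 1 :: 'a fps) (2 * m) (int m + 2 - 5 * i) * qpoch (fps_X ^ 1) N)
           (fps_X ^ nat (schur_exp1 i))" for i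
    using assms big[of i] by (intro X_power_qbin_qpoch_cong) linarith+
  ultimately show ?thesis
    unfolding schur_even_def sum_distrib_right left_diff_distrib
    by (intro fps_cong_sum fps_cong_diff) simp_all
qed

lemma jacobi_sum_qpoch_cong:
  assumes "2 * K \<le> n"
  shows "fps_cong K (jacobi_sum (fps_X :: 'a::field fps) A B n * qpoch (fps_X ^ 5) n)
           (\<Sum>s=A..B. sign s * fps_X ^ nat (jacobi_exp s))"
proof -
  have big: "K \<le> nat (jacobi_exp s)" if "int K \<le> \<bar>s\<bar>" for s
    using jacobi_exp_ge[of s] that by linarith
  have "fps_cong K (fps_X ^ nat (jacobi_exp s) * qbin (fps_X ^ 5 :: 'a fps) (2 * n) (int n + s) * qpoch (fps_X ^ 5) n)
           (fps_X ^ nat (jacobi_exp s))" for s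
    using assms big[of s] by (intro X_power_qbin_qpoch_cong) linarith+
  then show ?thesis
    unfolding jacobi_sum_def sum_distrib_right mult.assoc[of "sign _"]
    by (intro fps_cong_sum fps_cong_mult) simp_all
qed

definition rr_prod :: "'a::comm_ring_1 \<Rightarrow> nat \<Rightarrow> 'a" where
  "rr_prod q n = (\<Prod>i<n. (1 - q ^ (5 * i + 1)) * (1 - q ^ (5 * i + 4)))"

text \<open>The factors are sorted by residue modulo 5: residues 1 and 4 give
  \<open>rr_prod\<close>, residues 2 and 3 the triple product, and residue 0 the
  \<open>qpoch\<close> in q^5 by which the theta series is divided.\<close>

lemma qpoch_5:
  "qpoch q (5 * n) = rr_prod q n * ((\<Prod>i<n. (1 - q ^ (5 * i + 2)) * (1 - q ^ (5 * i + 3))) * qpoch (q ^ 5) n)"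
proof (induction n)
  case (Suc n)
  have "qpoch q (5 * Suc n) = qpoch q (Suc (Suc (Suc (Suc (Suc (5 * n))))))"
    by (simp add: numeral_eq_Suc)
  also have "\<dots> = qpoch q (5 * n) * (1 - q ^ (5 * n + 1)) * (1 - q ^ (5 * n + 2)) * (1 - q ^ (5 * n + 3))
      * (1 - q ^ (5 * n + 4)) * (1 - q ^ (5 * n + 5))"
    by (simp only: qpoch_Suc) (simp add: numeral_eq_Suc)
  also have "q ^ (5 * n + 5) = (q ^ 5) ^ Suc n"
    by (metis mult_Suc_right power_mult add.commute)
  finally show ?case
    unfolding Suc by (simp add: rr_prod_def qpoch_Suc mult_ac del: power_Suc)
qed (simp add: rr_prod_def)

text \<open>\<open>h\<close> collects the factors of \<open>qpoch fps_X (5 * n)\<close> outside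
  \<open>rr_prod\<close>. It is congruent to the theta series, and so is Schur's sum times
  \<open>qpoch fps_X (5 * n)\<close>; cancelling \<open>h\<close> leaves 1. The range is taken up to
  L + 1 so that the paired theta range contains n strictly even for n = L = 0.\<close>

lemma schur_even_rr_prod_cong:
  assumes "6 * K + 2 \<le> m" "2 * K \<le> n" "int n \<le> L"
  shows "fps_cong K (schur_even (fps_X :: 'a::field fps) (L + 1) m * rr_prod fps_X n) 1"
proof -
  define L' where "L' = L + 1"
  define h where "h = (\<Prod>i<n. (1 - fps_X ^ (5 * i + 2)) * (1 - fps_X ^ (5 * i + 3))) * qpoch (fps_X ^ 5 :: 'a fps) n"
  have "fps_nth (\<Prod>i<n. (1 - fps_X ^ (5 * i + 2)) * (1 - fps_X ^ (5 * i + 3)) :: 'a fps) 0 = 1" for n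
    by (induction n) auto
  then have h0: "fps_nth h 0 \<noteq> 0" by (simp add: h_def qpoch_nth_0)
  have "h = jacobi_sum fps_X (- 2 * L' - 1) (2 * L') n * qpoch (fps_X ^ 5) n"
    unfolding h_def using assms by (subst jacobi_sum_eq_prod) (auto simp: L'_def)
  then have "fps_cong K h (\<Sum>s=- 2 * L' - 1..2 * L'. sign s * fps_X ^ nat (jacobi_exp s))"
    using jacobi_sum_qpoch_cong assms by metis
  also have "(\<Sum>s=- 2 * L' - 1..2 * L'. sign s * fps_X ^ nat (jacobi_exp s) :: 'a fps)
      = (\<Sum>i=-L'..L'. fps_X ^ nat (schur_exp0 i) - fps_X ^ nat (schur_exp1 i))"
    unfolding sum_int_pairs jacobi_exp_even jacobi_exp_odd by (simp add: sign_def)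
  finally have 1: "fps_cong K \<dots> h" by (rule fps_cong_sym)
  have "fps_cong K (schur_even fps_X L' m * qpoch fps_X (5 * n)) (1 * h)"
    using fps_cong_trans[OF schur_even_qpoch_cong[of K m "5 * n" L'] 1] assms by simp
  then have "fps_cong K ((schur_even fps_X L' m * rr_prod fps_X n) * h) (1 * h)"
    by (simp add: qpoch_5 h_def mult.assoc)
  from fps_cong_mult_cancel[OF this h0] show ?thesis
    by (simp add: L'_def)
qed

section \<open>The first Rogers-Ramanujan identity\<close>

lemma length_le_sum_list: "(\<forall>x\<in>set xs. 0 < x) \<Longrightarrow> length xs \<le> sum_list xs" for xs :: "nat list"
  by (induction xs) auto

lemma finite_partitions_of: "finite (partitions_of N)"
proof (rule finite_subset)
  show "partitions_of N \<subseteq> {xs. set xs \<subseteq> {..N} \<and> length xs \<le> N}"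
    using length_le_sum_list by (auto simp: partitions_of_def member_le_sum_list)
  show "finite {xs. set xs \<subseteq> {..N} \<and> length xs \<le> N}"
    by (rule finite_lists_length_le) simp
qed

lemma sorted_wrt_mono: "sorted_wrt P xs \<Longrightarrow> (\<And>x y. P x y \<Longrightarrow> Q x y) \<Longrightarrow> sorted_wrt Q xs"
  by (rule sorted_wrt_mono_rel) auto

lemma transp_diff2: "transp (\<lambda>x y :: nat. y + 2 \<le> x)"
  by (auto simp: transp_def)

lemma Diff2_iff:
  "lam \<in> partitions_of N \<and> lam \<in> Diff2 \<longleftrightarrow>
    sorted_wrt (\<lambda>x y. y + 2 \<le> x) lam \<and> (\<forall>x\<in>set lam. 0 < x) \<and> sum_list lam = N"
proof -
  from sorted_wrt_iff_nth_Suc_transp[OF transp_diff2, of lam]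
  have "(\<forall>i. Suc i < length lam \<longrightarrow> lam ! Suc i + 2 \<le> lam ! i) \<longleftrightarrow> sorted_wrt (\<lambda>x y. y + 2 \<le> x) lam"
    by simp
  moreover have "sorted_wrt (\<ge>) lam" if "sorted_wrt (\<lambda>x y. y + 2 \<le> x) lam"
    using that by (rule sorted_wrt_mono) simp
  ultimately show ?thesis by (auto simp: Diff2_def partitions_of_def)
qed

section \<open>Generating functions with bounded largest part, for both kinds of partitions at
  once\<close>

definition bounded_lists :: "(nat \<Rightarrow> nat \<Rightarrow> bool) \<Rightarrow> (nat \<Rightarrow> bool) \<Rightarrow> nat \<Rightarrow> nat \<Rightarrow> nat list set" where
  "bounded_lists R P n N =
     {xs. sorted_wrt R xs \<and> (\<forall>x\<in>set xs. 0 < x \<and> x \<le> n \<and> P x) \<and> sum_list xs = N}"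

lemma finite_bounded_lists:
  assumes "\<And>x y. R x y \<Longrightarrow> y \<le> x"
  shows "finite (bounded_lists R P n N)"
proof (rule finite_subset[OF _ finite_partitions_of[of N]])
  have "sorted_wrt (\<ge>) xs" if "sorted_wrt R xs" for xs
    using that assms by (rule sorted_wrt_mono)
  then show "bounded_lists R P n N \<subseteq> partitions_of N"
    by (auto simp: bounded_lists_def partitions_of_def)
qed

text \<open>Rational coefficients: a field, so that series can be cancelled, and of characteristic
  0, so that cardinalities can be read off.\<close>

definition bounded_fps :: "(nat \<Rightarrow> nat \<Rightarrow> bool) \<Rightarrow> (nat \<Rightarrow> bool) \<Rightarrow> nat \<Rightarrow> rat fps" where
  "bounded_fps R P n = Abs_fps (\<lambda>N. of_nat (card (bounded_lists R P n N)))"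

lemma bounded_lists_0: "bounded_lists R P 0 N = (if N = 0 then {[]} else {})"
proof -
  have "(\<forall>x\<in>set xs. 0 < x \<and> x \<le> 0 \<and> P x) \<longleftrightarrow> xs = []" for xs by (cases xs) auto
  then have "bounded_lists R P 0 N = {xs. xs = [] \<and> sum_list xs = N}"
    unfolding bounded_lists_def by (metis sorted_wrt.simps(1))
  also have "\<dots> = (if N = 0 then {[]} else {})"
    by (auto simp: set_eq_iff)
  finally show ?thesis .
qed

lemma bounded_fps_0: "bounded_fps R P 0 = 1"
  by (rule fps_ext) (simp add: bounded_fps_def bounded_lists_0)

text \<open>Lists are split by whether they begin with n + 1. The bound n' is what such a head
  imposes on the tail: n - 1 for differences at least two, n + 1 itself for ordinary
  partitions.\<close>

lemma bounded_fps_Suc: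
  assumes R: "\<And>x y. R x y \<Longrightarrow> y \<le> x"
    and n': "\<And>y. 0 < y \<Longrightarrow> y \<le> Suc n \<Longrightarrow> P y \<Longrightarrow> R (Suc n) y \<longleftrightarrow> y \<le> n'" "n' \<le> Suc n"
  shows "bounded_fps R P (Suc n) = bounded_fps R P n + (if P (Suc n) then fps_X ^ Suc n * bounded_fps R P n' else 0)"
proof (rule fps_ext)
  fix N
  define S where "S = (if P (Suc n) \<and> Suc n \<le> N then (#) (Suc n) ` bounded_lists R P n' (N - Suc n) else {})"
  have "bounded_lists R P (Suc n) N = bounded_lists R P n N \<union> S"
  proof (intro equalityI subsetI)
    fix xs assume xs: "xs \<in> bounded_lists R P (Suc n) N"
    show "xs \<in> bounded_lists R P n N \<union> S"
    proof (cases xs)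
      case Nil
      then show ?thesis using xs by (auto simp: bounded_lists_def)
    next
      case (Cons a ys)
      show ?thesis
      proof (cases "a = Suc n")
        case True
        then have "ys \<in> bounded_lists R P n' (N - Suc n)"
          using xs Cons n' by (auto simp: bounded_lists_def)
        then show ?thesis using xs Cons True by (auto simp: bounded_lists_def S_def)
      next
        case False
        then have "a \<le> n" using xs Cons by (auto simp: bounded_lists_def)
        moreover have "\<forall>x\<in>set ys. x \<le> a" using xs Cons R by (simp add: bounded_lists_def)
        ultimately have "\<forall>x\<in>set xs. x \<le> n" using Cons by auto
        then show ?thesis using xs by (auto simp: bounded_lists_def)
      qed
    qed
  next
    fix xs assume "xs \<in> bounded_lists R P n N \<union> S"
    then consider "xs \<in> bounded_lists R P n N"
      | ys where "P (Suc n)" "Suc n \<le> N" "xs = Suc n # ys" "ys \<in> bounded_lists R P n' (N - Suc n)"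
      by (auto simp: S_def split: if_splits)
    then show "xs \<in> bounded_lists R P (Suc n) N"
    proof cases
      case 2
      then have "\<forall>y\<in>set ys. 0 < y \<and> y \<le> Suc n \<and> P y \<and> R (Suc n) y"
        using n' by (auto simp: bounded_lists_def)
      then show ?thesis using 2 by (simp add: bounded_lists_def)
    qed (auto simp: bounded_lists_def)
  qed
  moreover have "bounded_lists R P n N \<inter> S = {}"
  proof -
    have "Suc n # ys \<notin> bounded_lists R P n N" for ys by (simp add: bounded_lists_def)
    then show ?thesis by (auto simp: S_def)
  qed
  moreover have "finite (bounded_lists R P n N)" "finite S"
    using finite_bounded_lists[of R P, OF R] by (simp_all add: S_def)
  ultimately have "card (bounded_lists R P (Suc n) N) = card (bounded_lists R P n N) + card S"
    by (simp add: card_Un_disjoint)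
  moreover have "card S = (if P (Suc n) \<and> Suc n \<le> N then card (bounded_lists R P n' (N - Suc n)) else 0)"
    by (simp add: S_def card_image)
  ultimately show "fps_nth (bounded_fps R P (Suc n)) N
      = fps_nth (bounded_fps R P n + (if P (Suc n) then fps_X ^ Suc n * bounded_fps R P n' else 0)) N"
    by (simp add: bounded_fps_def fps_X_power_mult_nth del: power_Suc)
qed

abbreviation diff2_fps :: "nat \<Rightarrow> rat fps" where
  "diff2_fps \<equiv> bounded_fps (\<lambda>x y. y + 2 \<le> x) (\<lambda>_. True)"

text \<open>At n = 0 the truncated bound 0 is correct, since nothing can follow a part 1.\<close>

lemma diff2_fps_Suc: "diff2_fps (Suc n) = diff2_fps n + fps_X ^ Suc n * diff2_fps (n - 1)"
proof -
  have "diff2_fps (Suc n) = diff2_fps n + (if True then fps_X ^ Suc n * diff2_fps (n - 1) else 0)"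
    by (rule bounded_fps_Suc) auto
  then show ?thesis by simp
qed

text \<open>The bound n on the parts belongs to the upper index n + 1 in Schur's sum. Both parities
  go through one induction because each recurrence refers to the other.\<close>

lemma diff2_fps_schur:
  assumes "int m + 3 \<le> L"
  shows "diff2_fps (2 * m) = schur_odd fps_X L m \<and> diff2_fps (2 * m + 1) = schur_even fps_X L (Suc m)"
  using assms
proof (induction m)
  case 0
  then show ?case
    using diff2_fps_Suc[of 0] by (simp add: bounded_fps_0 schur_odd_0 schur_even_0 schur_even_Suc)
next
  case (Suc m)
  have IH: "diff2_fps (2 * m) = schur_odd fps_X L m" "diff2_fps (2 * m + 1) = schur_even fps_X L (Suc m)"
    using Suc by simp_all
  have "Suc (2 * m + 1) = 2 * Suc m" "2 * m + 2 = 2 * Suc m" "2 * m + 1 - 1 = 2 * m"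
    "Suc (2 * Suc m) = 2 * Suc m + 1" "2 * Suc m - 1 = 2 * m + 1" by simp_all
  note step = diff2_fps_Suc[of "2 * m + 1", unfolded this] diff2_fps_Suc[of "2 * Suc m", unfolded this]
    schur_odd_Suc[of m L fps_X, unfolded this]
  have 1: "diff2_fps (2 * Suc m) = schur_odd fps_X L (Suc m)"
    using Suc.prems by (subst step(3)) (simp_all only: step(1) IH of_nat_Suc)
  moreover have "diff2_fps (2 * Suc m + 1) = schur_even fps_X L (Suc (Suc m))"
    unfolding step(2) 1 IH schur_even_Suc[of _ _ "Suc m"] ..
  ultimately show ?case ..
qed

abbreviation (input) mod5_part :: "nat \<Rightarrow> bool" where
  "mod5_part x \<equiv> x mod 5 = 1 \<or> x mod 5 = 4"

abbreviation mod5_fps :: "nat \<Rightarrow> rat fps" where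
  "mod5_fps \<equiv> bounded_fps (\<ge>) mod5_part"

lemma mod5_fps_Suc:
  "mod5_part (Suc n) \<Longrightarrow> mod5_fps (Suc n) * (1 - fps_X ^ Suc n) = mod5_fps n"
  "\<not> mod5_part (Suc n) \<Longrightarrow> mod5_fps (Suc n) = mod5_fps n"
proof -
  have *: "mod5_fps (Suc n) = mod5_fps n + (if mod5_part (Suc n) then fps_X ^ Suc n * mod5_fps (Suc n) else 0)"
    by (rule bounded_fps_Suc) auto
  show "mod5_part (Suc n) \<Longrightarrow> mod5_fps (Suc n) * (1 - fps_X ^ Suc n) = mod5_fps n"
    using * by (simp add: algebra_simps)
  show "\<not> mod5_part (Suc n) \<Longrightarrow> mod5_fps (Suc n) = mod5_fps n"
    using * by simp
qed

lemma mod5_fps_rr_prod: "mod5_fps (5 * n) * rr_prod fps_X n = 1"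
proof (induction n)
  case 0
  then show ?case by (simp add: bounded_fps_0 rr_prod_def)
next
  case (Suc n)
  have up: "Suc (5 * n) = 5 * n + 1" "Suc (5 * n + 1) = 5 * n + 2" "Suc (5 * n + 2) = 5 * n + 3"
    "Suc (5 * n + 3) = 5 * n + 4" "Suc (5 * n + 4) = 5 * Suc n" by simp_all
  have "(5 * n + 1) mod 5 = 1" "(5 * n + 4) mod 5 = 4" by presburger+
  then have 1: "mod5_fps (5 * n + 1) * (1 - fps_X ^ (5 * n + 1)) = mod5_fps (5 * n)"
    and 4: "mod5_fps (5 * n + 4) * (1 - fps_X ^ (5 * n + 4)) = mod5_fps (5 * n + 3)"
    using mod5_fps_Suc(1)[of "5 * n", unfolded up] mod5_fps_Suc(1)[of "5 * n + 3", unfolded up] by blast+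
  have "\<not> mod5_part (5 * n + 2)" "\<not> mod5_part (5 * n + 3)" "\<not> mod5_part (5 * Suc n)" by presburger+
  then have 2: "mod5_fps (5 * n + 3) = mod5_fps (5 * n + 1)" and 3: "mod5_fps (5 * Suc n) = mod5_fps (5 * n + 4)"
    using mod5_fps_Suc(2)[of "5 * n + 1", unfolded up] mod5_fps_Suc(2)[of "5 * n + 2", unfolded up]
      mod5_fps_Suc(2)[of "5 * n + 4", unfolded up] by simp_all
  have "mod5_fps (5 * Suc n) * rr_prod fps_X (Suc n)
      = mod5_fps (5 * n + 4) * (1 - fps_X ^ (5 * n + 4)) * (1 - fps_X ^ (5 * n + 1)) * rr_prod fps_X n"
    unfolding 3 by (simp only: rr_prod_def prod.lessThan_Suc mult_ac)
  then show ?case by (simp only: 4 2 1 Suc)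
qed

theorem rogers_ramanujan:
  "card {mu \<in> partitions_of N. \<forall>x\<in>set mu. mod5_part x} = card {lam \<in> partitions_of N. lam \<in> Diff2}"
proof -
  \<comment> \<open>Modulo X^K the coefficient at N is still visible. n and m meet the thresholds of
    the congruence; moreover 5n and 2m + 1 exceed N, so that bounding the parts loses no
    partition.\<close>
  define K where "K = Suc N"
  define n where "n = 2 * K"
  define m where "m = 6 * K + 2"
  define L where "L = int n + int m + 3"
  have cong: "fps_cong K (schur_even fps_X (L + 1) (Suc m) * rr_prod fps_X n) (1 :: rat fps)"
    by (rule schur_even_rr_prod_cong) (auto simp: n_def m_def L_def)
  have "fps_cong K (schur_even fps_X (L + 1) (Suc m) * rr_prod fps_X n) (mod5_fps (5 * n) * rr_prod fps_X n)"
    using cong unfolding mod5_fps_rr_prod .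
  moreover have "fps_nth (rr_prod fps_X n :: rat fps) 0 \<noteq> 0"
  proof
    assume "fps_nth (rr_prod fps_X n :: rat fps) 0 = 0"
    then have "fps_nth (mod5_fps (5 * n) * rr_prod fps_X n) 0 = 0" by simp
    then show False unfolding mod5_fps_rr_prod by simp
  qed
  ultimately have "fps_cong K (schur_even fps_X (L + 1) (Suc m)) (mod5_fps (5 * n))"
    by (rule fps_cong_mult_cancel)
  moreover have "diff2_fps (2 * m + 1) = schur_even fps_X (L + 1) (Suc m)"
    using diff2_fps_schur[of m "L + 1"] by (simp add: L_def)
  ultimately have "fps_nth (diff2_fps (2 * m + 1)) N = fps_nth (mod5_fps (5 * n)) N"
    by (simp add: fps_cong_def K_def)
  moreover have le: "x \<le> 2 * m + 1" "x \<le> 5 * n" if "x \<in> set xs" "sum_list xs = N" for x xs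
    using member_le_sum_list[OF that(1)] that(2) by (simp_all add: m_def n_def K_def)
  moreover have "bounded_lists (\<lambda>x y. y + 2 \<le> x) (\<lambda>_. True) (2 * m + 1) N = {lam \<in> partitions_of N. lam \<in> Diff2}"
    unfolding Diff2_iff bounded_lists_def using le(1) by blast
  moreover have "bounded_lists (\<ge>) mod5_part (5 * n) N = {mu \<in> partitions_of N. \<forall>x\<in>set mu. mod5_part x}"
    unfolding partitions_of_def bounded_lists_def using le(2) by blast
  ultimately show ?thesis by (simp add: bounded_fps_def)
qed

section \<open>Column multisets\<close>

text \<open>In a decreasing list the entries \<ge> c form an initial segment. This is the duality
  between rows and columns, with rows counted from 0.\<close>

lemma less_length_filter_ge:
  fixes mu :: "nat list"
  assumes "sorted_wrt (\<ge>) mu" "i < length mu"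
  shows "i < length (filter (\<lambda>x. c \<le> x) mu) \<longleftrightarrow> c \<le> mu ! i"
  using assms
proof (induction mu arbitrary: i)
  case (Cons a mu)
  show ?case
  proof (cases "c \<le> a")
    case True
    then show ?thesis using Cons by (cases i) auto
  next
    case False
    then have "\<forall>x\<in>set (a # mu). x < c" using Cons.prems by auto
    moreover from this have "filter (\<lambda>x. c \<le> x) (a # mu) = []"
      by (intro filter_False) auto
    moreover have "(a # mu) ! i \<in> set (a # mu)" using Cons.prems by (intro nth_mem)
    ultimately show ?thesis by (metis leD length_0_conv not_less_zero)
  qed
qed simp

lemma le_MaxI: "x \<in> set mu \<Longrightarrow> x \<le> Max (insert 0 (set mu))" for mu :: "nat list"
  by (rule Max_ge) auto

text \<open>Row i is met exactly by the columns longer than i. Together with its length, a list with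
  trailing zeros can thus be recovered from its columns.\<close>

lemma length_filter_conjugate:
  assumes "sorted_wrt (\<ge>) mu" "i < length mu"
  shows "length (filter (\<lambda>x. i < x) (conjugate mu)) = mu ! i"
proof -
  define M where "M = Max (insert 0 (set mu))"
  have "mu ! i \<le> M" unfolding M_def using assms by (intro le_MaxI nth_mem)
  have "length (filter (\<lambda>x. i < x) (conjugate mu)) = length (filter (\<lambda>c. c \<le> mu ! i) [1..<Suc M])"
    unfolding conjugate_def M_def[symmetric] filter_map length_map o_def
    using assms less_length_filter_ge[OF assms] by simp
  also have "\<dots> = card (set (filter (\<lambda>c. c \<le> mu ! i) [1..<Suc M]))"
    by (intro distinct_card[symmetric]) simp
  also have "set (filter (\<lambda>c. c \<le> mu ! i) [1..<Suc M]) = {1..mu ! i}"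
    using \<open>mu ! i \<le> M\<close> by auto
  finally show ?thesis by simp
qed

lemma length_filter_le_mono:
  "(\<And>x. P x \<Longrightarrow> Q x) \<Longrightarrow> length (filter P xs) \<le> length (filter Q xs)"
  by (induction xs) auto

lemma conjugate_parts:
  assumes "x \<in> set (conjugate mu)"
  shows "0 < x" "x \<le> length mu"
proof -
  define M where "M = Max (insert 0 (set mu))"
  obtain c where c: "1 \<le> c" "c \<le> M" "x = length (filter (\<lambda>x. c \<le> x) mu)"
    using assms unfolding conjugate_def M_def[symmetric] by auto
  then show "x \<le> length mu" by simp
  have "M \<in> insert 0 (set mu)" unfolding M_def by (rule Max_in) auto
  then have "M \<in> set (filter (\<lambda>x. c \<le> x) mu)" using c by auto
  then show "0 < x" unfolding c(3) by (rule length_pos_if_in_set)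
qed

lemma sorted_conjugate: "sorted_wrt (\<ge>) (conjugate mu)"
proof -
  have "sorted_wrt (<) [1..<Suc (Max (insert 0 (set mu)))]" by (rule sorted_wrt_upt)
  then have "sorted_wrt (\<lambda>c d. length (filter (\<lambda>x. d \<le> x) mu) \<le> length (filter (\<lambda>x. c \<le> x) mu)) [1..<Suc (Max (insert 0 (set mu)))]"
    by (rule sorted_wrt_mono) (auto intro: length_filter_le_mono)
  then show ?thesis by (simp add: conjugate_def sorted_wrt_map del: upt_Suc)
qed

text \<open>The cells of the diagram are counted by rows instead of columns.\<close>

lemma sum_list_eq_sum_filter:
  fixes c :: "nat list"
  assumes "\<forall>x\<in>set c. x \<le> m"
  shows "sum_list c = (\<Sum>i<m. length (filter (\<lambda>x. i < x) c))"
  using assms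
proof (induction c)
  case (Cons x c)
  have "(\<Sum>i<m. length (filter (\<lambda>y. i < y) (x # c)))
      = (\<Sum>i<m. (if i < x then 1 else 0) + length (filter (\<lambda>y. i < y) c))"
    by (intro sum.cong) auto
  also have "\<dots> = (\<Sum>i<m. if i < x then 1 else 0) + sum_list c"
    using Cons by (simp add: sum.distrib)
  also have "(\<Sum>i<m. if i < x then 1 else 0) = card ({..<m} \<inter> {i. i < x})"
    by (simp add: sum.If_cases)
  also have "{..<m} \<inter> {i. i < x} = {..<x}" using Cons.prems by auto
  finally show ?case by simp
qed simp

lemma length_filter_less_Suc:
  "length (filter (\<lambda>y. i < y) c) = count_list c (Suc i) + length (filter (\<lambda>y. Suc i < y) c)"
  by (induction c) auto

lemma sorted_ge_unique:
  fixes xs ys :: "nat list"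
  assumes "sorted_wrt (\<ge>) xs" "sorted_wrt (\<ge>) ys" "mset xs = mset ys"
  shows "xs = ys"
proof -
  have "sorted (rev xs)" "sorted (rev ys)"
    using assms(1,2) by (simp_all add: sorted_wrt_rev)
  moreover have "mset (rev xs) = mset (rev ys)" using assms(3) by simp
  ultimately have "rev xs = rev ys" by (metis properties_for_sort)
  then show ?thesis by simp
qed

lemma partitions_of_sorted: "c \<in> partitions_of n \<Longrightarrow> sorted_wrt (\<ge>) c"
  by (simp add: partitions_of_def)

text \<open>Multiplicities are differences of consecutive tail counts, tail counts from m on are 0,
  and a decreasing list is determined by its multiplicities.\<close>

lemma partition_eqI:
  assumes c: "c \<in> partitions_of n" "\<forall>x\<in>set c. x \<le> m"
    and d: "d \<in> partitions_of n'" "\<forall>x\<in>set d. x \<le> m"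
    and eq: "\<And>i. i < m \<Longrightarrow> length (filter (\<lambda>x. i < x) c) = length (filter (\<lambda>x. i < x) d)"
  shows "c = d"
proof -
  have "length (filter (\<lambda>x. i < x) c) = length (filter (\<lambda>x. i < x) d)" for i
  proof (cases "i < m")
    case False
    then have "filter (\<lambda>x. i < x) c = []" "filter (\<lambda>x. i < x) d = []"
      using c(2) d(2) by (force simp: filter_empty_conv)+
    then show ?thesis by simp
  qed (rule eq)
  then have "count_list c (Suc i) = count_list d (Suc i)" for i
    using length_filter_less_Suc[of i c] length_filter_less_Suc[of i d] by simp
  moreover have "count_list c 0 = 0" "count_list d 0 = 0"
    using c(1) d(1) by (auto simp: partitions_of_def count_list_0_iff)
  ultimately have "count_list c x = count_list d x" for x by (cases x) simp_all
  then have "mset c = mset d" by (intro multiset_eqI) (simp add: count_mset)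
  then show ?thesis using c(1) d(1) by (intro sorted_ge_unique) (simp_all add: partitions_of_sorted)
qed

section \<open>Removing the staircase 2m-1, ..., 3, 1, the smallest member of \<open>Diff2\<close>
  with m parts\<close>

definition staircase :: "nat \<Rightarrow> nat \<Rightarrow> nat" where
  "staircase m i = 2 * (m - i) - 1"

lemma sum_staircase: "(\<Sum>i<m. staircase m i) = m * m"
proof (induction m)
  case (Suc m)
  have "(\<Sum>i<Suc m. staircase (Suc m) i) = staircase (Suc m) 0 + (\<Sum>i<m. staircase m i)"
    unfolding sum.lessThan_Suc_shift by (simp add: staircase_def)
  then show ?case by (simp add: Suc) (simp add: staircase_def)
qed simp

lemma staircase_Suc: "Suc i < m \<Longrightarrow> staircase m i = staircase m (Suc i) + 2"
  by (simp add: staircase_def)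

lemma staircase_le_nth:
  fixes lam :: "nat list"
  assumes "sorted_wrt (\<lambda>x y. y + 2 \<le> x) lam" "\<forall>x\<in>set lam. 0 < x" "i < length lam"
  shows "staircase (length lam) i \<le> lam ! i"
  using assms
proof (induction lam arbitrary: i)
  case (Cons a lam)
  show ?case
  proof (cases i)
    case 0
    show ?thesis
    proof (cases "lam = []")
      case True
      then show ?thesis using Cons.prems 0 by (simp add: staircase_def)
    next
      case False
      then have "staircase (length lam) 0 \<le> lam ! 0" "lam ! 0 + 2 \<le> a"
        using Cons by auto
      then show ?thesis using 0 False by (simp add: staircase_def)
    qed
  next
    case (Suc j)
    then show ?thesis using Cons.IH[of j] Cons.prems by (simp add: staircase_def)
  qed
qed simp

lemma sum_list_map_upt: "sum_list (map f [0..<m]) = (\<Sum>i<m. f i)" for f :: "nat \<Rightarrow> nat"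
  by (simp add: sum_list_sum_nth atLeast0LessThan)

lemma col_eq: "col lam = conjugate (map (\<lambda>i. lam ! i - staircase (length lam) i) [0..<length lam])"
  by (simp add: col_def staircase_def Let_def)

definition Diff2_of :: "nat \<Rightarrow> nat \<Rightarrow> nat list set" where
  "Diff2_of m N = {lam \<in> partitions_of N. lam \<in> Diff2 \<and> length lam = m}"

lemma Diff2_of_iff:
  "lam \<in> Diff2_of m N \<longleftrightarrow> sorted_wrt (\<lambda>x y. y + 2 \<le> x) lam \<and> (\<forall>x\<in>set lam. 0 < x) \<and> sum_list lam = N \<and> length lam = m"
  using Diff2_iff[of lam N] by (auto simp: Diff2_of_def)

lemma transp_ge: "transp ((\<ge>) :: nat \<Rightarrow> nat \<Rightarrow> bool)"
  by (auto simp: transp_def)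

context
  fixes lam m N
  assumes lam: "lam \<in> Diff2_of m N"
begin

text \<open>Zero entries are kept, so that positions correspond to those of \<open>lam\<close>;
  \<open>conjugate\<close> ignores them.\<close>

definition rows where "rows = map (\<lambda>i. lam ! i - staircase m i) [0..<m]"

lemma lam_nth: "i < m \<Longrightarrow> lam ! i = rows ! i + staircase m i"
  using lam staircase_le_nth[of lam i] by (simp add: Diff2_of_iff rows_def)

lemma col_rows: "col lam = conjugate rows"
  using lam by (simp add: col_eq Diff2_of_iff rows_def)

lemma length_rows: "length rows = m"
  by (simp add: rows_def)

lemma sorted_rows: "sorted_wrt (\<ge>) rows"
proof -
  have "lam ! Suc i + 2 \<le> lam ! i" if "Suc i < m" for i
    using lam that sorted_wrt_nth_less[of "\<lambda>x y. y + 2 \<le> x" lam i "Suc i"] by (simp add: Diff2_of_iff)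
  then have "rows ! Suc i \<le> rows ! i" if "Suc i < m" for i
    using that lam_nth[of i] lam_nth[of "Suc i"] staircase_Suc[OF that] by fastforce
  then show ?thesis
    by (simp add: sorted_wrt_iff_nth_Suc_transp[OF transp_ge] length_rows)
qed

lemma length_filter_col: "i < m \<Longrightarrow> length (filter (\<lambda>x. i < x) (col lam)) = rows ! i"
  unfolding col_rows using sorted_rows length_rows by (simp add: length_filter_conjugate)

lemma col_parts: "x \<in> set (col lam) \<Longrightarrow> 0 < x \<and> x \<le> m"
  using conjugate_parts[of x rows] by (simp add: col_rows length_rows)

lemma sum_list_Diff2_of: "N = sum_list (col lam) + m * m"
proof -
  have "N = (\<Sum>i<m. lam ! i)"
    using lam by (auto simp: Diff2_of_iff sum_list_sum_nth lessThan_atLeast0)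
  also have "\<dots> = (\<Sum>i<m. rows ! i + staircase m i)"
    by (intro sum.cong) (simp_all add: lam_nth)
  also have "\<dots> = (\<Sum>i<m. rows ! i) + m * m"
    by (simp add: sum.distrib sum_staircase)
  also have "(\<Sum>i<m. rows ! i) = sum_list (col lam)"
    using sum_list_eq_sum_filter[of "col lam" m] col_parts by (simp add: length_filter_col)
  finally show ?thesis .
qed

end

text \<open>The inverse turns columns back into rows and adds the staircase of size m^2. The
  condition \<open>m * m \<le> N\<close> guards the subtraction, which would otherwise truncate to 0
  and admit the empty partition.\<close>

lemma bij_betw_col:
  "bij_betw col (Diff2_of m N) {c \<in> partitions_of (N - m * m). m * m \<le> N \<and> (\<forall>x\<in>set c. x \<le> m)}"
  (is "bij_betw col _ ?C")
  unfolding bij_betw_def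
proof
  show "inj_on col (Diff2_of m N)"
  proof (rule inj_onI)
    fix lam lam' assume *: "lam \<in> Diff2_of m N" "lam' \<in> Diff2_of m N" "col lam = col lam'"
    have "lam ! i = lam' ! i" if "i < m" for i
      using * that length_filter_col[of lam m N i] length_filter_col[of lam' m N i]
        lam_nth[of lam m N i] lam_nth[of lam' m N i] by simp
    then show "lam = lam'"
      using * by (intro nth_equalityI) (simp_all add: Diff2_of_iff)
  qed
  show "col ` Diff2_of m N = ?C"
  proof (intro equalityI subsetI)
    fix c assume "c \<in> col ` Diff2_of m N"
    then obtain lam where lam: "lam \<in> Diff2_of m N" "c = col lam" by auto
    have "sorted_wrt (\<ge>) c" unfolding lam(2) col_def Let_def by (rule sorted_conjugate)
    then show "c \<in> ?C"
      using sum_list_Diff2_of[OF lam(1)] col_parts[OF lam(1)] by (simp add: lam(2) partitions_of_def)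
  next
    fix c assume c: "c \<in> ?C"
    define f where "f i = length (filter (\<lambda>x. i < x) c)" for i
    define lam where "lam = map (\<lambda>i. f i + staircase m i) [0..<m]"
    have f_mono: "f (Suc i) \<le> f i" for i
      unfolding f_def by (rule length_filter_le_mono) simp
    have nth: "lam ! i = f i + staircase m i" if "i < m" for i
      using that by (simp add: lam_def)
    have "sorted_wrt (\<lambda>x y. y + 2 \<le> x) lam"
      unfolding sorted_wrt_iff_nth_Suc_transp[OF transp_diff2]
    proof (intro allI impI)
      fix i assume "Suc i < length lam"
      then have "Suc i < m" by (simp add: lam_def)
      then show "lam ! Suc i + 2 \<le> lam ! i"
        using nth[of i] nth[of "Suc i"] staircase_Suc[of i m] f_mono[of i] by simp
    qed
    moreover have "\<forall>x\<in>set lam. 0 < x"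
      by (auto simp: lam_def staircase_def)
    moreover have "sum_list lam = N"
    proof -
      have "sum_list lam = (\<Sum>i<m. f i) + m * m"
        by (simp add: lam_def sum_list_map_upt sum.distrib sum_staircase del: map_map)
      also have "(\<Sum>i<m. f i) = sum_list c"
        using c sum_list_eq_sum_filter[of c m] by (simp add: f_def)
      finally show ?thesis using c by (simp add: partitions_of_def)
    qed
    ultimately have lam_in: "lam \<in> Diff2_of m N"
      by (simp add: Diff2_of_iff) (simp add: lam_def)
    have "col lam = c"
    proof (rule partition_eqI)
      show "col lam \<in> partitions_of (sum_list (col lam))"
        using col_parts[OF lam_in] by (simp add: partitions_of_def col_def Let_def sorted_conjugate)
      show "c \<in> partitions_of (N - m * m)" "\<forall>x\<in>set c. x \<le> m" using c by auto
      show "\<forall>x\<in>set (col lam). x \<le> m" using col_parts[OF lam_in] by auto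
      fix i assume "i < m"
      then show "length (filter (\<lambda>x. i < x) (col lam)) = length (filter (\<lambda>x. i < x) c)"
        using length_filter_col[OF lam_in, of i] lam_nth[OF lam_in, of i] nth[of i] by (simp add: f_def)
    qed
    then show "c \<in> col ` Diff2_of m N" using lam_in by blast
  qed
qed

text \<open>On multisets the removal and insertion of marked parts is plain subtraction and
  addition.\<close>

lemma bij_betw_mset_partitions:
  "bij_betw mset (partitions_of N) {M. 0 \<notin># M \<and> sum_mset M = N}"
  unfolding bij_betw_def
proof
  show "inj_on mset (partitions_of N)"
    by (intro inj_onI sorted_ge_unique) (auto simp: partitions_of_def)
  show "mset ` partitions_of N = {M. 0 \<notin># M \<and> sum_mset M = N}"
  proof (intro equalityI subsetI)
    fix M assume M: "M \<in> {M. 0 \<notin># M \<and> sum_mset M = N}"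
    define xs where "xs = rev (sorted_list_of_multiset M)"
    have xs: "mset xs = M" "sorted_wrt (\<ge>) xs"
      by (simp_all add: xs_def sorted_wrt_rev)
    then have "xs \<in> partitions_of N"
      using M by (auto simp: partitions_of_def sum_mset_sum_list[symmetric] simp flip: set_mset_mset intro: gr0I)
    then show "M \<in> mset ` partitions_of N" using xs by blast
  qed (auto simp: partitions_of_def sum_mset_sum_list)
qed

lemma card_bij_betw_Collect:
  assumes "bij_betw f A B" "\<And>x. x \<in> A \<Longrightarrow> P x \<longleftrightarrow> Q (f x)"
  shows "card {x \<in> A. P x} = card {y \<in> B. Q y}"
proof -
  have "f ` {x \<in> A. P x} = {y \<in> B. Q y}"
    using assms by (auto simp: bij_betw_def)
  moreover have "inj_on f {x \<in> A. P x}"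
    using assms by (auto simp: bij_betw_def inj_on_def)
  ultimately show ?thesis by (metis card_image)
qed

text \<open>N is the size of the partition in \<open>Diff2\<close>, not of its column multiset M;
  hence the m^2 cells of the staircase.\<close>

definition bounded_msets :: "nat \<Rightarrow> nat \<Rightarrow> nat multiset set" where
  "bounded_msets m N = {M. (\<forall>x\<in>#M. 1 \<le> x \<and> x \<le> m) \<and> sum_mset M + m * m = N}"

lemma card_Diff2_of_Collect:
  "card {lam \<in> Diff2_of m N. P (mset (col lam))} = card {M \<in> bounded_msets m N. P M}"
proof -
  let ?C = "{c \<in> partitions_of (N - m * m). m * m \<le> N \<and> (\<forall>x\<in>set c. x \<le> m)}"
  have "card {lam \<in> Diff2_of m N. P (mset (col lam))} = card {c \<in> ?C. P (mset c)}"
    by (rule card_bij_betw_Collect[OF bij_betw_col]) simp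
  also have "{c \<in> ?C. P (mset c)} = {c \<in> partitions_of (N - m * m). m * m \<le> N \<and> (\<forall>x\<in>set c. x \<le> m) \<and> P (mset c)}"
    by auto
  also have "card \<dots> = card {M \<in> {M. 0 \<notin># M \<and> sum_mset M = N - m * m}. m * m \<le> N \<and> (\<forall>x\<in>#M. x \<le> m) \<and> P M}"
    by (rule card_bij_betw_Collect[OF bij_betw_mset_partitions]) simp
  also have "{M \<in> {M. 0 \<notin># M \<and> sum_mset M = N - m * m}. m * m \<le> N \<and> (\<forall>x\<in>#M. x \<le> m) \<and> P M}
     = {M \<in> bounded_msets m N. P M}"
  proof -
    have "0 \<notin># M \<and> (\<forall>x\<in>#M. x \<le> m) \<longleftrightarrow> (\<forall>x\<in>#M. 1 \<le> x \<and> x \<le> m)" for M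
      by (metis less_one linorder_not_le)
    then show ?thesis unfolding bounded_msets_def by auto
  qed
  finally show ?thesis .
qed

section \<open>The statistic on partitions with difference at least two\<close>

text \<open>The power of q that accompanies x^k y^j z^l in 1 / ((1-xq)(1-yq^4)(1-zq^6)).\<close>

fun weight :: "nat \<times> nat \<times> nat \<Rightarrow> nat" where
  "weight (k, j, l) = k + 4 * j + 6 * l"

lemma card_mset_shift:
  fixes R :: "'a multiset"
  assumes "\<And>M. M \<in> A \<Longrightarrow> R \<subseteq># M \<and> M - R \<in> B" "\<And>M. M \<in> B \<Longrightarrow> M + R \<in> A"
  shows "card A = card B"
proof -
  have "A = (\<lambda>M. M + R) ` B"
  proof (intro equalityI subsetI)
    fix M assume "M \<in> A"
    then show "M \<in> (\<lambda>M. M + R) ` B"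
      using assms(1)[of M] by (intro image_eqI[of _ _ "M - R"]) auto
  qed (use assms(2) in auto)
  moreover have "inj_on (\<lambda>M. M + R) B" by (simp add: inj_on_def)
  ultimately show ?thesis by (simp add: card_image)
qed

lemma sum_mset_replicate: "sum_mset (replicate_mset n x) = n * x" for x :: nat
  by (induction n) auto

lemma sum_mset_diff_nat: "R \<subseteq># M \<Longrightarrow> sum_mset M = sum_mset (M - R) + sum_mset R" for M :: "nat multiset"
  by (metis subset_mset.diff_add sum_mset.union)

definition mod5_msets :: "nat \<Rightarrow> nat \<times> nat \<times> nat \<Rightarrow> nat multiset set" where
  "mod5_msets N t = {M. (\<forall>x\<in>#M. mod5_part x) \<and> sum_mset M = N \<and> (count M 1, count M 4, count M 6) = t}"

lemma card_mod5_msets: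
  "card (mod5_msets N t) = (if weight t \<le> N then card (mod5_msets (N - weight t) (0, 0, 0)) else 0)"
proof -
  obtain k j l where t: "t = (k, j, l)" by (cases t)
  define R where "R = replicate_mset k 1 + replicate_mset j 4 + replicate_mset l (6 :: nat)"
  have sum_R: "sum_mset R = weight t" by (simp add: R_def t sum_mset_replicate)
  have sub: "R \<subseteq># M" if "M \<in> mod5_msets N t" for M
    using that by (intro mset_subset_eqI) (auto simp: R_def mod5_msets_def t)
  show ?thesis
  proof (cases "weight t \<le> N")
    case True
    have "card (mod5_msets N t) = card (mod5_msets (N - weight t) (0, 0, 0))"
    proof (rule card_mset_shift[of _ R])
      fix M assume M: "M \<in> mod5_msets N t"
      then show "R \<subseteq># M \<and> M - R \<in> mod5_msets (N - weight t) (0, 0, 0)"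
        using sub[OF M] sum_mset_diff_nat[OF sub[OF M]] sum_R
        by (auto simp: mod5_msets_def t R_def dest: in_diffD)
    next
      fix M assume "M \<in> mod5_msets (N - weight t) (0, 0, 0)"
      then show "M + R \<in> mod5_msets N t"
        using True sum_R by (auto simp: mod5_msets_def t R_def split: if_splits)
    qed
    then show ?thesis using True by simp
  next
    case False
    have "mod5_msets N t = {}"
    proof (intro equals0I)
      fix M assume M: "M \<in> mod5_msets N t"
      then show False using sum_mset_diff_nat[OF sub[OF M]] sum_R False by (auto simp: mod5_msets_def)
    qed
    then show ?thesis using False by simp
  qed
qed

text \<open>The triple (k, j, l) that conditions (1)-(5) assign to a partition with m parts whose
  column multiset is M.\<close>

definition stat :: "nat \<Rightarrow> nat multiset \<Rightarrow> nat \<times> nat \<times> nat" where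
  "stat m M =
    (if m \<ge> 6 then (count M 1, count M 4, count M 6)
     else if m \<ge> 4 then (count M 1, count M 4, count M 3 div 2)
     else if m = 3 then (count M 1, count M 2 div 2,
       if odd (count M 3) \<and> even (count M 2) then (count M 3 + 3) div 2 else count M 3 div 2)
     else if m = 2 then
       (if even (count M 2) then (count M 1, count M 2 div 2 + 1, 0) else (count M 1, count M 2 div 2, 1))
     else (count M 1 + 1, 0, 0))"

definition stat_msets :: "nat \<Rightarrow> nat \<Rightarrow> nat \<times> nat \<times> nat \<Rightarrow> nat multiset set" where
  "stat_msets m N t = {M \<in> bounded_msets m N. stat m M = t}"

lemma stat_msets_empty: "N < m * m \<Longrightarrow> stat_msets m N t = {}"
  by (auto simp: stat_msets_def bounded_msets_def)

text \<open>A triple is realised by a multiset \<open>R\<close> of columns whose sum is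
  \<open>weight t\<close>: with at least six parts the marked columns themselves, with four or five
  parts 2l columns of length 3 instead of l of length 6. An odd column of length 3 stays behind in
  the remainder.\<close>

lemma card_stat_msets_ge4:
  assumes "4 \<le> m"
  shows "card (stat_msets m N t) = (if weight t \<le> N then card (stat_msets m (N - weight t) (0, 0, 0)) else 0)"
proof -
  obtain k j l where t: "t = (k, j, l)" by (cases t)
  define R where "R = replicate_mset k 1 + replicate_mset j 4 +
    (if m \<ge> 6 then replicate_mset l 6 else replicate_mset (2 * l) (3 :: nat))"
  have sum_R: "sum_mset R = weight t" by (simp add: R_def t sum_mset_replicate)
  have sub: "R \<subseteq># M" if "M \<in> stat_msets m N t" for M
    using that assms
    by (intro mset_subset_eqI) (auto simp: R_def stat_msets_def stat_def t split: if_splits)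
  have R_set: "1 \<le> x \<and> x \<le> m" if "x \<in># R" for x
    using that assms by (auto simp: R_def split: if_splits)
  show ?thesis
  proof (cases "weight t \<le> N")
    case True
    have "card (stat_msets m N t) = card (stat_msets m (N - weight t) (0, 0, 0))"
    proof (rule card_mset_shift[of _ R])
      fix M assume M: "M \<in> stat_msets m N t"
      have "stat m (M - R) = (0, 0, 0)"
        using M assms by (auto simp: stat_msets_def stat_def t R_def split: if_splits)
      then show "R \<subseteq># M \<and> M - R \<in> stat_msets m (N - weight t) (0, 0, 0)"
        using M sub[OF M] sum_mset_diff_nat[OF sub[OF M]] sum_R
        by (auto simp: stat_msets_def bounded_msets_def dest: in_diffD)
    next
      fix M assume M: "M \<in> stat_msets m (N - weight t) (0, 0, 0)"
      have "stat m (M + R) = t"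
        using M assms by (auto simp: stat_msets_def stat_def t R_def split: if_splits)
      then show "M + R \<in> stat_msets m N t"
        using M True sum_R R_set by (auto simp: stat_msets_def bounded_msets_def)
    qed
    then show ?thesis using True by simp
  next
    case False
    have "stat_msets m N t = {}"
    proof (intro equals0I)
      fix M assume M: "M \<in> stat_msets m N t"
      then show False using sum_mset_diff_nat[OF sub[OF M]] sum_R False
        by (auto simp: stat_msets_def bounded_msets_def)
    qed
    then show ?thesis using False by simp
  qed
qed

section \<open>At most three parts\<close>

definition mset321 :: "nat \<Rightarrow> nat \<Rightarrow> nat \<Rightarrow> nat multiset" where
  "mset321 a b c = replicate_mset a 3 + replicate_mset b 2 + replicate_mset c 1"

lemma count_mset321:
  "count (mset321 a b c) 1 = c" "count (mset321 a b c) 2 = b" "count (mset321 a b c) 3 = a"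
  by (simp_all add: mset321_def)

lemma mset321_eq_iff: "mset321 a b c = mset321 a' b' c' \<longleftrightarrow> a = a' \<and> b = b' \<and> c = c'"
  by (metis count_mset321)

lemma eq_mset321:
  assumes "\<forall>x\<in>#M. 1 \<le> x \<and> x \<le> 3"
  shows "M = mset321 (count M 3) (count M 2) (count M 1)"
proof (rule multiset_eqI)
  fix x
  show "count M x = count (mset321 (count M 3) (count M 2) (count M 1)) x"
  proof (cases "x \<in> {1, 2, 3}")
    case False
    have "x \<notin># M"
    proof
      assume "x \<in># M"
      then have "1 \<le> x \<and> x \<le> 3" using assms by blast
      then have "x \<in> {1, 2, 3}" by (simp add: numeral_eq_Suc) linarith
      then show False using False by blast
    qed
    then have "count M x = 0" by (simp only: not_in_iff)
    then show ?thesis using False by (simp add: mset321_def)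
  qed (auto simp: mset321_def)
qed

lemma bounded_msets_small:
  "bounded_msets 1 N = {mset321 0 0 c | c. c + 1 = N}"
  "bounded_msets 2 N = {mset321 0 b c | b c. 2 * b + c + 4 = N}"
  "bounded_msets 3 N = {mset321 a b c | a b c. 3 * a + 2 * b + c + 9 = N}"
proof -
  have sum: "sum_mset (mset321 a b c) = 3 * a + 2 * b + c" for a b c
    by (simp add: mset321_def sum_mset_replicate)
  have *: "bounded_msets m N = {mset321 a b c | a b c.
      (m < 3 \<longrightarrow> a = 0) \<and> (m < 2 \<longrightarrow> b = 0) \<and> 3 * a + 2 * b + c + m * m = N}" if m: "1 \<le> m" "m \<le> 3" for m
  proof (intro equalityI subsetI)
    fix M assume "M \<in> bounded_msets m N"
    then have M: "\<forall>x\<in>#M. 1 \<le> x \<and> x \<le> m" "sum_mset M + m * m = N" by (auto simp: bounded_msets_def)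
    then have eq: "M = mset321 (count M 3) (count M 2) (count M 1)"
      using m by (intro eq_mset321) auto
    have "m < 3 \<longrightarrow> count M 3 = 0" "m < 2 \<longrightarrow> count M 2 = 0"
      using M(1) by (auto simp: not_in_iff[symmetric])
    moreover have "3 * count M 3 + 2 * count M 2 + count M 1 + m * m = N"
      using M(2) sum eq by metis
    ultimately show "M \<in> {mset321 a b c | a b c.
      (m < 3 \<longrightarrow> a = 0) \<and> (m < 2 \<longrightarrow> b = 0) \<and> 3 * a + 2 * b + c + m * m = N}"
      using eq by blast
  next
    fix M assume "M \<in> {mset321 a b c | a b c.
      (m < 3 \<longrightarrow> a = 0) \<and> (m < 2 \<longrightarrow> b = 0) \<and> 3 * a + 2 * b + c + m * m = N}"
    then obtain a b c where M: "M = mset321 a b c" "m < 3 \<longrightarrow> a = 0" "m < 2 \<longrightarrow> b = 0"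
      "3 * a + 2 * b + c + m * m = N" by blast
    moreover have "\<forall>x\<in>#M. 1 \<le> x \<and> x \<le> m"
      using M(2,3) m unfolding M(1) mset321_def by (auto split: if_splits)
    ultimately show "M \<in> bounded_msets m N" by (simp add: bounded_msets_def sum)
  qed
  show "bounded_msets 1 N = {mset321 0 0 c | c. c + 1 = N}"
    by (subst *) auto
  show "bounded_msets 2 N = {mset321 0 b c | b c. 2 * b + c + 4 = N}"
    by (subst *) auto
  show "bounded_msets 3 N = {mset321 a b c | a b c. 3 * a + 2 * b + c + 9 = N}"
    by (subst *) auto
qed

lemma card_stat_msets_1:
  "card (stat_msets 1 N (k, j, l)) = (if N = weight (k, j, l) \<and> 1 \<le> k \<and> j = 0 \<and> l = 0 then 1 else 0)"
proof -
  have "stat_msets 1 N (k, j, l) = (if N = weight (k, j, l) \<and> 1 \<le> k \<and> j = 0 \<and> l = 0 then {mset321 0 0 (k - 1)} else {})"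
    unfolding stat_msets_def bounded_msets_small stat_def by (auto simp: count_mset321[simplified] mset321_eq_iff)
  then show ?thesis by simp
qed

lemma stat_2:
  "stat 2 M = (k, j, l) \<longleftrightarrow> count M 1 = k \<and>
    (count M 2 = 2 * j - 2 \<and> 1 \<le> j \<and> l = 0 \<or> count M 2 = 2 * j + 1 \<and> l = 1)"
proof -
  define b where "b = count M 2"
  have "even b \<and> b div 2 + 1 = j \<and> l = 0 \<or> odd b \<and> b div 2 = j \<and> l = 1 \<longleftrightarrow>
    b = 2 * j - 2 \<and> 1 \<le> j \<and> l = 0 \<or> b = 2 * j + 1 \<and> l = 1"
    by presburger
  then show ?thesis by (auto simp: stat_def b_def)
qed

text \<open>The four cells of the staircase make up for the two 2's that 2j - 2 lacks, so j 4's are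
  accounted for; together with an odd 2 they amount to a single 6.\<close>

lemma card_stat_msets_2:
  "card (stat_msets 2 N (k, j, l)) =
    (if N = weight (k, j, l) \<and> (l = 0 \<and> 1 \<le> j \<or> l = 1) then 1 else 0)"
proof -
  have "stat_msets 2 N (k, j, l) =
    {mset321 0 b c | b c. 2 * b + c + 4 = N \<and>
       c = k \<and> (b = 2 * j - 2 \<and> 1 \<le> j \<and> l = 0 \<or> b = 2 * j + 1 \<and> l = 1)}"
    unfolding stat_msets_def bounded_msets_small by (auto simp: stat_2 count_mset321[simplified])
  also have "\<dots> = (if N = weight (k, j, l) \<and> (l = 0 \<and> 1 \<le> j \<or> l = 1)
     then {mset321 0 (if l = 0 then 2 * j - 2 else 2 * j + 1) k} else {})"
    by (auto simp: mset321_eq_iff)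
  finally show ?thesis by simp
qed

lemma stat_3:
  "stat 3 M = (k, j, l) \<longleftrightarrow> count M 1 = k \<and>
    (count M 3 = 2 * l \<and> count M 2 = 2 * j \<or> count M 3 = 2 * l \<and> count M 2 = 2 * j + 1 \<or>
     count M 3 = 2 * l - 3 \<and> count M 2 = 2 * j \<and> 2 \<le> l \<or> count M 3 = 2 * l + 1 \<and> count M 2 = 2 * j + 1)"
proof -
  define a b where "a = count M 3" and "b = count M 2"
  have *: "b div 2 = j \<and> (if odd a \<and> even b then (a + 3) div 2 else a div 2) = l \<longleftrightarrow>
    (a = 2 * l \<and> b = 2 * j \<or> a = 2 * l \<and> b = 2 * j + 1 \<or>
     a = 2 * l - 3 \<and> b = 2 * j \<and> 2 \<le> l \<or> a = 2 * l + 1 \<and> b = 2 * j + 1)"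
  proof -
    obtain a' b' where "a = 2 * a' \<or> a = 2 * a' + 1" "b = 2 * b' \<or> b = 2 * b' + 1"
      by (meson evenE oddE)
    moreover have "(2 * a' + 1 + 3) div 2 = a' + 2" by simp
    ultimately show ?thesis by (elim disjE; simp; presburger)
  qed
  have "stat 3 M = (count M 1, b div 2, if odd a \<and> even b then (a + 3) div 2 else a div 2)"
    by (simp add: stat_def a_def b_def)
  then show ?thesis unfolding a_def[symmetric] b_def[symmetric] by (simp only: prod.inject *)
qed

text \<open>With 2l - 3 columns of length 3 the nine cells of the staircase replace the missing
  three 3's, and the size is exactly the weight. In the other cases the nine cells are surplus,
  along with nothing, a 2, or a 3 and a 2: 9, 11, 14.\<close>

lemma card_stat_msets_3:
  "card (stat_msets 3 N (k, j, l)) =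
    (if N = weight (k, j, l) \<and> 2 \<le> l \<or> N = weight (k, j, l) + 9
        \<or> N = weight (k, j, l) + 11 \<or> N = weight (k, j, l) + 14 then 1 else 0)"
proof -
  have stat: "stat 3 (mset321 a b c) = (k, j, l) \<longleftrightarrow> c = k \<and>
    (a = 2 * l \<and> b = 2 * j \<or> a = 2 * l \<and> b = 2 * j + 1 \<or>
     a = 2 * l - 3 \<and> b = 2 * j \<and> 2 \<le> l \<or> a = 2 * l + 1 \<and> b = 2 * j + 1)" for a b c
    by (simp only: stat_3 count_mset321)
  have "stat_msets 3 N (k, j, l) =
    {mset321 a b c | a b c. 3 * a + 2 * b + c + 9 = N \<and> stat 3 (mset321 a b c) = (k, j, l)}"
    unfolding stat_msets_def bounded_msets_small by blast
  also have "\<dots> =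
    {mset321 a b c | a b c. 3 * a + 2 * b + c + 9 = N \<and> c = k \<and>
    (a = 2 * l \<and> b = 2 * j \<or> a = 2 * l \<and> b = 2 * j + 1 \<or>
     a = 2 * l - 3 \<and> b = 2 * j \<and> 2 \<le> l \<or> a = 2 * l + 1 \<and> b = 2 * j + 1)}"
    unfolding stat ..
  also have "\<dots> = (if N = weight (k, j, l) \<and> 2 \<le> l then {mset321 (2 * l - 3) (2 * j) k}
     else if N = weight (k, j, l) + 9 then {mset321 (2 * l) (2 * j) k}
     else if N = weight (k, j, l) + 11 then {mset321 (2 * l) (2 * j + 1) k}
     else if N = weight (k, j, l) + 14 then {mset321 (2 * l + 1) (2 * j + 1) k} else {})"
  proof -
    have "3 * (2 * l - 3) + 2 * (2 * j) + k + 9 = N \<longleftrightarrow> N = weight (k, j, l)" if "2 \<le> l"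
      using that by auto
    moreover have "3 * (2 * l) + 2 * (2 * j) + k + 9 = N \<longleftrightarrow> N = weight (k, j, l) + 9"
      "3 * (2 * l) + 2 * (2 * j + 1) + k + 9 = N \<longleftrightarrow> N = weight (k, j, l) + 11"
      "3 * (2 * l + 1) + 2 * (2 * j + 1) + k + 9 = N \<longleftrightarrow> N = weight (k, j, l) + 14"
      by auto
    ultimately have "{mset321 a b c | a b c. 3 * a + 2 * b + c + 9 = N \<and> c = k \<and>
      (a = 2 * l \<and> b = 2 * j \<or> a = 2 * l \<and> b = 2 * j + 1 \<or>
       a = 2 * l - 3 \<and> b = 2 * j \<and> 2 \<le> l \<or> a = 2 * l + 1 \<and> b = 2 * j + 1)} =
      {M. N = weight (k, j, l) \<and> 2 \<le> l \<and> M = mset321 (2 * l - 3) (2 * j) k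
        \<or> N = weight (k, j, l) + 9 \<and> M = mset321 (2 * l) (2 * j) k
        \<or> N = weight (k, j, l) + 11 \<and> M = mset321 (2 * l) (2 * j + 1) k
        \<or> N = weight (k, j, l) + 14 \<and> M = mset321 (2 * l + 1) (2 * j + 1) k}"
      by blast
    then show ?thesis by (simp del: weight.simps)
  qed
  finally show ?thesis by simp
qed

text \<open>For N = \<open>weight t\<close> exactly one length contributes: one part if j = l = 0,
  two parts if l = 0 < j or l = 1, three parts if 2 \<le> l. The zero triple, which these leave out,
  has weight 0 and is excluded by 1 \<le> N.\<close>

lemma card_stat_msets_le3:
  assumes "1 \<le> N"
  shows "(\<Sum>m\<in>{1, 2, 3}. card (stat_msets m N t)) =
    (if weight t \<le> N \<and> N - weight t \<in> {0, 9, 11, 14} then 1 else 0)"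
proof -
  obtain k j l where t: "t = (k, j, l)" by (cases t)
  have "(\<Sum>m\<in>{1, 2, 3}. card (stat_msets m N t))
      = card (stat_msets 1 N t) + card (stat_msets 2 N t) + card (stat_msets 3 N t)"
    by simp
  also have "\<dots> = (if weight t \<le> N \<and> N - weight t \<in> {0, 9, 11, 14} then 1 else 0)"
  proof (cases "N = weight t")
    case True
    then show ?thesis
      using assms unfolding t card_stat_msets_1 card_stat_msets_2 card_stat_msets_3
      by (cases "l = 0"; cases "l = 1"; cases "j = 0") simp_all
  next
    case False
    then have "N = weight t + 9 \<or> N = weight t + 11 \<or> N = weight t + 14
      \<longleftrightarrow> weight t \<le> N \<and> N - weight t \<in> {0, 9, 11, 14}"
      by auto
    then show ?thesis
      using False unfolding t card_stat_msets_1 card_stat_msets_2 card_stat_msets_3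
      by (simp only: simp_thms if_False add_0)
  qed
  finally show ?thesis .
qed

definition diff2_stat :: "nat \<Rightarrow> nat \<times> nat \<times> nat \<Rightarrow> nat list set" where
  "diff2_stat N t = {lam \<in> partitions_of N. lam \<in> Diff2 \<and> stat (length lam) (mset (col lam)) = t}"

text \<open>The summand for 0, 9, 11, 14 is the contribution of at most three parts: with a = xq,
  b = yq^4, c = zq^6, the generating functions for 0, 1, 2 and 3 parts have the common denominator
  (1-a)(1-b)(1-c) and the numerators (1-a)(1-b)(1-c), a(1-b)(1-c), (b+c)(1-c) and
  q^9 + q^11 + c^2 + q^14, and these add up to 1 + q^9 + q^11 + q^14. The empty partition is the
  reason why N = 0 has to be excluded below.\<close>

definition diff2_core :: "nat \<Rightarrow> nat" where
  "diff2_core N = (\<Sum>m=4..N + 3. card (stat_msets m N (0, 0, 0))) + (if N \<in> {0, 9, 11, 14} then 1 else 0)"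

lemma card_diff2_stat:
  assumes "1 \<le> N"
  shows "card (diff2_stat N t) = (if weight t \<le> N then diff2_core (N - weight t) else 0)"
proof -
  have len: "length lam \<in> {1..N}" if "lam \<in> partitions_of N" for lam
    using that assms length_le_sum_list[of lam] by (cases lam) (auto simp: partitions_of_def)
  \<comment> \<open>Lengths above N do not occur; the range goes up to N + 3 so that it contains 1,
    2 and 3 for every N.\<close>
  have "diff2_stat N t = (\<Union>m\<in>{1..N + 3}. {lam \<in> Diff2_of m N. stat m (mset (col lam)) = t})"
    using len by (fastforce simp: diff2_stat_def Diff2_of_def)
  also have "card \<dots> = (\<Sum>m=1..N + 3. card {lam \<in> Diff2_of m N. stat m (mset (col lam)) = t})"
  proof (rule card_UN_disjoint)
    show "\<forall>m\<in>{1..N + 3}. finite {lam \<in> Diff2_of m N. stat m (mset (col lam)) = t}"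
      using finite_partitions_of[of N] by (auto simp: Diff2_of_def)
  qed (auto simp: Diff2_of_def)
  also have "\<dots> = (\<Sum>m=1..N + 3. card (stat_msets m N t))"
    using card_Diff2_of_Collect[where P = "\<lambda>M. stat m M = t" for m] by (simp add: stat_msets_def)
  also have "{1..N + 3} = {1, 2, 3} \<union> {4..N + 3}" by auto
  also have "(\<Sum>m\<in>{1, 2, 3} \<union> {4..N + 3}. card (stat_msets m N t))
      = (\<Sum>m\<in>{1, 2, 3}. card (stat_msets m N t)) + (\<Sum>m=4..N + 3. card (stat_msets m N t))"
    by (rule sum.union_disjoint) auto
  finally have 1: "card (diff2_stat N t)
      = (if weight t \<le> N \<and> N - weight t \<in> {0, 9, 11, 14} then 1 else 0)
      + (\<Sum>m=4..N + 3. if weight t \<le> N then card (stat_msets m (N - weight t) (0, 0, 0)) else 0)"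
    unfolding card_stat_msets_le3[OF assms] by (simp add: card_stat_msets_ge4 del: insert_iff)
  show ?thesis
  proof (cases "weight t \<le> N")
    case True
    have "(\<Sum>m=4..N + 3. card (stat_msets m (N - weight t) (0, 0, 0)))
        = (\<Sum>m=4..N - weight t + 3. card (stat_msets m (N - weight t) (0, 0, 0)))"
    proof (rule sum.mono_neutral_right)
      have "stat_msets m (N - weight t) (0, 0, 0) = {}" if "N - weight t + 3 < m" for m
      proof (rule stat_msets_empty)
        show "N - weight t < m * m" using that le_square[of m] by linarith
      qed
      then show "\<forall>m\<in>{4..N + 3} - {4..N - weight t + 3}. card (stat_msets m (N - weight t) (0, 0, 0)) = 0"
        by auto
    qed auto
    then show ?thesis using True unfolding 1 by (simp add: diff2_core_def del: insert_iff)
  next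
    case False
    then show ?thesis unfolding 1 by simp
  qed
qed

section \<open>Comparing the two counts\<close>

definition mod5_stat :: "nat \<Rightarrow> nat \<times> nat \<times> nat \<Rightarrow> nat list set" where
  "mod5_stat N t = {mu \<in> partitions_of N. (\<forall>x\<in>set mu. mod5_part x) \<and>
     (count_list mu 1, count_list mu 4, count_list mu 6) = t}"

lemma card_mod5_stat:
  "card (mod5_stat N t) = (if weight t \<le> N then card (mod5_msets (N - weight t) (0, 0, 0)) else 0)"
proof -
  have "card (mod5_stat N t) = card {M \<in> {M. 0 \<notin># M \<and> sum_mset M = N}.
      (\<forall>x\<in>#M. mod5_part x) \<and> (count M 1, count M 4, count M 6) = t}"
    unfolding mod5_stat_def by (rule card_bij_betw_Collect[OF bij_betw_mset_partitions]) (simp add: count_mset)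
  also have "{M \<in> {M. 0 \<notin># M \<and> sum_mset M = N}.
      (\<forall>x\<in>#M. mod5_part x) \<and> (count M 1, count M 4, count M 6) = t} = mod5_msets N t"
    by (auto simp: mod5_msets_def)
  finally show ?thesis by (simp only: card_mod5_msets[of N t])
qed

lemma sum_card_fibres:
  assumes "finite S" "finite T" "\<And>x. x \<in> S \<Longrightarrow> f x \<notin> T \<Longrightarrow> False"
  shows "(\<Sum>t\<in>T. card {x \<in> S. f x = t}) = card S"
  using sum.group[OF assms(1,2), of f "\<lambda>_. 1 :: nat"] assms(3) by auto

lemma weight_bound: "weight t \<le> N \<Longrightarrow> t \<in> {..N} \<times> {..N} \<times> {..N}"
  by (cases t) auto

lemma sum_card_mod5_stat:
  "(\<Sum>t\<in>{..N} \<times> {..N} \<times> {..N}. card (mod5_stat N t)) = card {mu \<in> partitions_of N. \<forall>x\<in>set mu. mod5_part x}"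
proof -
  let ?S = "{mu \<in> partitions_of N. \<forall>x\<in>set mu. mod5_part x}"
  let ?f = "\<lambda>mu. (count_list mu 1, count_list mu 4, count_list mu 6)"
  have eq: "mod5_stat N t = {mu \<in> ?S. ?f mu = t}" for t
    by (auto simp: mod5_stat_def)
  \<comment> \<open>Read off from the counting formula: a triple of weight above N has no
    partitions, but \<open>mu\<close> is one for its own triple. This confines the triples to a
    finite box.\<close>
  have "weight (?f mu) \<le> N" if "mu \<in> ?S" for mu
  proof (rule ccontr)
    assume "\<not> weight (?f mu) \<le> N"
    then have "card (mod5_stat N (?f mu)) = 0" unfolding card_mod5_stat by simp
    moreover have "finite (mod5_stat N (?f mu))" using finite_partitions_of by (simp add: mod5_stat_def)
    ultimately have "mod5_stat N (?f mu) = {}" by simp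
    then show False using that by (auto simp: eq)
  qed
  then have "?f mu \<in> {..N} \<times> {..N} \<times> {..N}" if "mu \<in> ?S" for mu
    using that by (intro weight_bound)
  then show ?thesis
    unfolding eq using finite_partitions_of by (intro sum_card_fibres) (simp, simp, blast)
qed

lemma sum_card_diff2_stat:
  assumes "1 \<le> N"
  shows "(\<Sum>t\<in>{..N} \<times> {..N} \<times> {..N}. card (diff2_stat N t)) = card {lam \<in> partitions_of N. lam \<in> Diff2}"
proof -
  let ?S = "{lam \<in> partitions_of N. lam \<in> Diff2}"
  let ?f = "\<lambda>lam. stat (length lam) (mset (col lam))"
  have eq: "diff2_stat N t = {lam \<in> ?S. ?f lam = t}" for t
    by (auto simp: diff2_stat_def)
  have "weight (?f lam) \<le> N" if "lam \<in> ?S" for lam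
  proof (rule ccontr)
    assume "\<not> weight (?f lam) \<le> N"
    then have "card (diff2_stat N (?f lam)) = 0" unfolding card_diff2_stat[OF assms] by simp
    moreover have "finite (diff2_stat N (?f lam))" using finite_partitions_of by (simp add: diff2_stat_def)
    ultimately have "diff2_stat N (?f lam) = {}" by simp
    then show False using that by (auto simp: eq)
  qed
  then have "?f lam \<in> {..N} \<times> {..N} \<times> {..N}" if "lam \<in> ?S" for lam
    using that by (intro weight_bound)
  then show ?thesis
    unfolding eq using finite_partitions_of by (intro sum_card_fibres) (simp, simp, blast)
qed

lemma card_mod5_msets_eq_diff2_core: "card (mod5_msets N (0, 0, 0)) = diff2_core N"
proof (induction N rule: less_induct)
  case (less N)
  show ?case
  proof (cases "N = 0")
    case True
    have "mod5_msets 0 (0, 0, 0) = {{#}}"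
    proof -
      have "M = {#}" if "M \<in> mod5_msets 0 (0, 0, 0)" for M
      proof (rule ccontr)
        assume "M \<noteq> {#}"
        then obtain x where "x \<in># M" by blast
        moreover have "M = {#}" if "\<forall>x\<in>#M. x = 0" "\<forall>x\<in>#M. mod5_part x"
          using that by (cases M) auto
        ultimately show False using that \<open>M \<noteq> {#}\<close> by (auto simp: mod5_msets_def)
      qed
      then show ?thesis by (auto simp: mod5_msets_def)
    qed
    then show ?thesis using True by (simp add: diff2_core_def)
  next
    case False
    define T where "T = {..N} \<times> {..N} \<times> {..N}"
    define a where "a t = card (mod5_stat N t)" for t
    define b where "b t = card (diff2_stat N t)" for t
    have T: "finite T" "(0, 0, 0) \<in> T" by (auto simp: T_def)
    have "sum a T = sum b T"
    proof -
      have "sum a T = card {mu \<in> partitions_of N. \<forall>x\<in>set mu. mod5_part x}"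
        unfolding a_def T_def by (rule sum_card_mod5_stat)
      also have "\<dots> = card {lam \<in> partitions_of N. lam \<in> Diff2}"
        by (rule rogers_ramanujan)
      also have "\<dots> = sum b T"
        unfolding b_def T_def using False by (intro sum_card_diff2_stat[symmetric]) simp
      finally show ?thesis .
    qed
    moreover have "a t = b t" if "t \<in> T - {(0, 0, 0)}" for t
    proof -
      \<comment> \<open>Hence N - \<open>weight t\<close> < N, and the induction hypothesis equates
        all summands except the one at the zero triple.\<close>
      have "0 < weight t" using that by (cases t) auto
      then show ?thesis
        using False less.IH[of "N - weight t"] by (simp add: a_def b_def card_mod5_stat card_diff2_stat)
    qed
    then have "sum a (T - {(0, 0, 0)}) = sum b (T - {(0, 0, 0)})"
      by (intro sum.cong) auto
    ultimately have "a (0, 0, 0) = b (0, 0, 0)"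
      using sum.remove[OF T, of a] sum.remove[OF T, of b] by simp
    then show ?thesis using False by (simp add: a_def b_def card_mod5_stat card_diff2_stat)
  qed
qed

text \<open>A decreasing list with entries among 1, 2 and 3 is determined by three multiplicities.
  This translates the list equations for at most three parts into the counts used by
  \<open>stat\<close>.\<close>

lemma col_eq_parts321:
  assumes "lam \<in> Diff2_of m N" "m \<le> 3"
  shows "col lam = parts321 a b c \<longleftrightarrow>
    count (mset (col lam)) 3 = a \<and> count (mset (col lam)) 2 = b \<and> count (mset (col lam)) 1 = c"
proof -
  have mset: "mset (parts321 a b c) = mset321 a b c"
    by (simp add: parts321_def mset321_def)
  have "sorted_wrt (\<ge>) (replicate n x)" for n and x :: nat
    by (induction n) auto
  then have "sorted_wrt (\<ge>) (parts321 a b c)"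
    by (auto simp: parts321_def sorted_wrt_append)
  moreover have "sorted_wrt (\<ge>) (col lam)"
    unfolding col_def Let_def by (rule sorted_conjugate)
  ultimately have "col lam = parts321 a b c \<longleftrightarrow> mset (col lam) = mset321 a b c"
    using sorted_ge_unique[of "col lam" "parts321 a b c"] mset by metis
  moreover have "\<forall>x\<in>#mset (col lam). 1 \<le> x \<and> x \<le> 3"
    using col_parts[OF assms(1)] assms(2) by fastforce
  ultimately show ?thesis
    using eq_mset321[of "mset (col lam)"] count_mset321[of a b c] by metis
qed

theorem corollary4:
  fixes N k j l :: nat
  assumes "N \<ge> 1"
  shows
    "card {mu \<in> partitions_of N.
        (\<forall>x\<in>set mu. x mod 5 = 1 \<or> x mod 5 = 4) \<and>
        count_list mu 1 = k \<and> count_list mu 4 = j \<and> count_list mu 6 = l} =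
     card {lam \<in> partitions_of N. lam \<in> Diff2 \<and>
        (length lam \<ge> 6 \<longrightarrow>
           count_list (col lam) 1 = k \<and> count_list (col lam) 4 = j \<and>
           count_list (col lam) 6 = l) \<and>
        (length lam = 4 \<or> length lam = 5 \<longrightarrow>
           count_list (col lam) 1 = k \<and> count_list (col lam) 4 = j \<and>
           (count_list (col lam) 3 = 2 * l \<or> count_list (col lam) 3 = 2 * l + 1)) \<and>
        (length lam = 3 \<longrightarrow>
           col lam = parts321 (2 * l) (2 * j) k \<or>
           col lam = parts321 (2 * l) (2 * j + 1) k \<or>
           (col lam = parts321 (2 * l - 3) (2 * j) k \<and> l \<ge> 2) \<or>
           col lam = parts321 (2 * l + 1) (2 * j + 1) k) \<and>
        (length lam = 2 \<longrightarrow>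
           (col lam = parts321 0 (2 * j - 2) k \<and> j \<ge> 1 \<and> l = 0) \<or>
           (col lam = parts321 0 (2 * j + 1) k \<and> l = 1)) \<and>
        (length lam = 1 \<longrightarrow>
           col lam = parts321 0 0 (k - 1) \<and> k \<ge> 1 \<and> j = 0 \<and> l = 0)}"
    (is "card ?A = card {lam \<in> partitions_of N. lam \<in> Diff2 \<and> ?cond lam}")
proof -
  have cond_iff: "?cond lam \<longleftrightarrow> stat (length lam) (mset (col lam)) = (k, j, l)"
    if lam: "lam \<in> partitions_of N" "lam \<in> Diff2" for lam
  proof -
    define M where "M = mset (col lam)"
    have in_m: "lam \<in> Diff2_of (length lam) N" using lam by (simp add: Diff2_of_def)
    have p: "col lam = parts321 a b c \<longleftrightarrow> count M 3 = a \<and> count M 2 = b \<and> count M 1 = c"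
      if "length lam \<le> 3" for a b c
      unfolding M_def by (rule col_eq_parts321[OF in_m that])
    \<comment> \<open>No column is longer than the number of parts, which accounts for the zero
      multiplicities in \<open>parts321\<close> for one and two parts.\<close>
    have z: "count M x = 0" if "length lam < x" for x
      using col_parts[OF in_m, of x] that by (auto simp: M_def count_mset count_list_0_iff)
    have c: "count_list (col lam) x = count M x" for x by (simp add: M_def count_mset)
    \<comment> \<open>The empty partition would satisfy all five implications vacuously; 1 \<le> N
      rules it out.\<close>
    have "length lam \<noteq> 0" using lam assms by (auto simp: partitions_of_def)
    then consider "length lam \<ge> 6" | "length lam = 4 \<or> length lam = 5" | "length lam = 3"
      | "length lam = 2" | "length lam = 1"
      by linarith
    then show ?thesis
    proof cases
      case 1
      then show ?thesis by (auto simp: c stat_def simp flip: M_def)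
    next
      case 2
      then show ?thesis by (auto simp: c stat_def simp flip: M_def)
    next
      case 3
      then have "length lam \<le> 3" by simp
      then show ?thesis
        unfolding M_def[symmetric] 3 stat_3 p[OF \<open>length lam \<le> 3\<close>] by simp blast
    next
      case 4
      then have "length lam \<le> 3" "count M 3 = 0" by (simp_all add: z)
      then show ?thesis
        unfolding M_def[symmetric] 4 stat_2 p[OF \<open>length lam \<le> 3\<close>] by simp blast
    next
      case 5
      then have "length lam \<le> 3" "count M 3 = 0" "count M 2 = 0" by (simp_all add: z)
      then show ?thesis
        unfolding M_def[symmetric] 5 p[OF \<open>length lam \<le> 3\<close>] by (auto simp: stat_def)
    qed
  qed
  have "{lam \<in> partitions_of N. lam \<in> Diff2 \<and> ?cond lam} = diff2_stat N (k, j, l)"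
    unfolding diff2_stat_def by (intro Collect_cong conj_cong refl cond_iff)
  moreover have "?A = mod5_stat N (k, j, l)"
    by (simp add: mod5_stat_def)
  ultimately show ?thesis
    using assms by (simp only: card_mod5_stat card_diff2_stat card_mod5_msets_eq_diff2_core)
qed

end
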